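(* Let $X_1,\dots,X_n$ be Polish spaces, $X=X_1\times\dots\times X_n$, $\mu=(\mu_1,\dots,\mu_n)$ with $\mu_k$ a Borel probability measure on $X_k$, let $c\in C_L(\mu)$, and let $W\subset C_L(\mu)$ be a linear subspace such that for every $k$ and every $f\in C_L(\mu_k)$ with $f\circ\operatorname{Pr}_k\in W$ one has $\int_{X_k}f\,d\mu_k=0$. Suppose $\pi_*\in\Pi_W(\mu)$ is a minimizer of $$\inf_{\pi\in\Pi_W(\mu)}\int_X c\,d\pi .$$ Then $\pi_*$ is a $(c,W)$-monotone transport plan, i.e. there is a $(c,W)$-monotone set $\Gamma\subset X$ with $\pi_*(\Gamma)=1$.
   Context: $\operatorname{Pr}_k:X\to X_k$ is the natural projection. $\Pi(\mu)$ is the set of Borel probability measures on $X$ whose marginals are $\mu_1,\dots,\mu_n$. $C_L(\mu_i)=L^1(X_i,\mu_i)\cap C(X_i)$ is the space of continuous real-valued $\mu_i$-integrable functions on $X_i$. $C_L(\mu)$ is the space of all continuous $h:X\to\mathbb{R}$ for which there exist $f_i\in C_L(\mu_i)$ ($i=1,\dots,n$) with $|h(x)|\le\sum_{i=1}^n f_i(x_i)$ for all $x=(x_1,\dots,x_n)\in X$. (Every $h\in C_L(\mu)$ is integrable with respect to every $\pi\in\Pi(\mu)$.) For a linear subspace $W\subset C_L(\mu)$, $\Pi_W(\mu)=\{\pi\in\Pi(\mu):\int_X w\,d\pi=0\ \text{for all } w\in W\}$. For two (nonnegative, finite Borel) measures $\alpha,\beta$ on $X$, write $\alpha\sim_W\beta$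 if $(\operatorname{Pr}_k)_\#\alpha=(\operatorname{Pr}_k)_\#\beta$ for all $k=1,\dots,n$ and $\int\omega\,d\alpha=\int\omega\,d\beta$ for all $\omega\in W$. A set $\Gamma\subset X$ is called $(c,W)$-monotone if for every $m\in\mathbb{N}$, every set $S_m\subset\Gamma$ of $m$ points, every measure $\beta_s$ with $\operatorname{supp}(\beta_s)=S_m$, and every measure $\alpha\sim_W\beta_s$, one has $\int c\,d\beta_s\le\int c\,d\alpha$. *)

theory Defs
  imports "HOL-Probability.Probability"
begin

text \<open>
  The spaces are topologies \<open>X k\<close>, \<open>k \<in> {1..n}\<close>, on subsets (the carriers \<open>topspace (X k)\<close>)
  of one common type. This allows \<open>n\<close> different Polish spaces: embed them into their disjoint sum.
  Points of the product are extensional functions on \<open>{1..n}\<close>, the projection to the \<open>k\<close>-th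
  factor is \<open>\<lambda>x. x k\<close>.

  A real function on a space is represented by the unique function that agrees with it on the
  carrier and is \<open>undefined\<close> outside it (\<open>extensional\<close>), so that equality of representatives is
  equality of functions on the space.
\<close>

definition polish_topology :: "'a topology \<Rightarrow> bool" where
  "polish_topology T \<longleftrightarrow> separable_space T \<and> completely_metrizable_space T"

definition borel_of :: "'a topology \<Rightarrow> 'a measure" where
  "borel_of T = sigma (topspace T) {U. openin T U}"

abbreviation prod_space :: "nat \<Rightarrow> (nat \<Rightarrow> 'a topology) \<Rightarrow> (nat \<Rightarrow> 'a) topology" where
  "prod_space n X \<equiv> product_topology X {1..n}"

definition borel_prob :: "'a topology \<Rightarrow> 'a measure \<Rightarrow> bool" where
  "borel_prob T M \<longleftrightarrow> sets M = sets (borel_of T) \<and> prob_space M"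

definition finite_borel :: "'a topology \<Rightarrow> 'a measure \<Rightarrow> bool" where
  "finite_borel T M \<longleftrightarrow> sets M = sets (borel_of T) \<and> finite_measure M"

definition marginal :: "(nat \<Rightarrow> 'a topology) \<Rightarrow> nat \<Rightarrow> (nat \<Rightarrow> 'a) measure \<Rightarrow> 'a measure" where
  "marginal X k M = distr M (borel_of (X k)) (\<lambda>x. x k)"

definition transport_plans ::
    "nat \<Rightarrow> (nat \<Rightarrow> 'a topology) \<Rightarrow> (nat \<Rightarrow> 'a measure) \<Rightarrow> (nat \<Rightarrow> 'a) measure set" where
  "transport_plans n X \<mu> =
     {\<pi>. borel_prob (prod_space n X) \<pi> \<and> (\<forall>k\<in>{1..n}. marginal X k \<pi> = \<mu> k)}"

definition C_L1 :: "'a topology \<Rightarrow> 'a measure \<Rightarrow> ('a \<Rightarrow> real) set" where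
  "C_L1 T M = {f \<in> extensional (topspace T). continuous_map T euclideanreal f \<and> integrable M f}"

definition C_L ::
    "nat \<Rightarrow> (nat \<Rightarrow> 'a topology) \<Rightarrow> (nat \<Rightarrow> 'a measure) \<Rightarrow> ((nat \<Rightarrow> 'a) \<Rightarrow> real) set" where
  "C_L n X \<mu> =
     {h \<in> extensional (topspace (prod_space n X)).
        continuous_map (prod_space n X) euclideanreal h \<and>
        (\<exists>f. (\<forall>i\<in>{1..n}. f i \<in> C_L1 (X i) (\<mu> i)) \<and>
             (\<forall>x\<in>topspace (prod_space n X). \<bar>h x\<bar> \<le> (\<Sum>i=1..n. f i (x i))))}"

text \<open>Linear subspaces of the space of real functions on the set \<open>S\<close>.\<close>

definition function_subspace :: "'b set \<Rightarrow> ('b \<Rightarrow> real) set \<Rightarrow> bool" where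
  "function_subspace S W \<longleftrightarrow>
     W \<subseteq> extensional S \<and>
     (\<lambda>x\<in>S. 0) \<in> W \<and>
     (\<forall>u\<in>W. \<forall>v\<in>W. (\<lambda>x\<in>S. u x + v x) \<in> W) \<and>
     (\<forall>a. \<forall>u\<in>W. (\<lambda>x\<in>S. a * u x) \<in> W)"

definition constrained_plans ::
    "nat \<Rightarrow> (nat \<Rightarrow> 'a topology) \<Rightarrow> (nat \<Rightarrow> 'a measure) \<Rightarrow> ((nat \<Rightarrow> 'a) \<Rightarrow> real) set
      \<Rightarrow> (nat \<Rightarrow> 'a) measure set" where
  "constrained_plans n X \<mu> W = {\<pi> \<in> transport_plans n X \<mu>. \<forall>w\<in>W. (\<integral>x. w x \<partial>\<pi>) = 0}"

definition supp :: "'b topology \<Rightarrow> 'b measure \<Rightarrow> 'b set" where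
  "supp T M = {x \<in> topspace T. \<forall>U. openin T U \<and> x \<in> U \<longrightarrow> emeasure M U > 0}"

definition W_equivalent ::
    "nat \<Rightarrow> (nat \<Rightarrow> 'a topology) \<Rightarrow> ((nat \<Rightarrow> 'a) \<Rightarrow> real) set
      \<Rightarrow> (nat \<Rightarrow> 'a) measure \<Rightarrow> (nat \<Rightarrow> 'a) measure \<Rightarrow> bool" where
  "W_equivalent n X W \<alpha> \<beta> \<longleftrightarrow>
     (\<forall>k\<in>{1..n}. marginal X k \<alpha> = marginal X k \<beta>) \<and>
     (\<forall>w\<in>W. (\<integral>x. w x \<partial>\<alpha>) = (\<integral>x. w x \<partial>\<beta>))"

text \<open>
  A measure with finite support in a Polish space is concentrated on that support, so
  \<open>\<beta>\<close> below, and likewise \<open>\<alpha>\<close> because its marginals are those of \<open>\<beta>\<close>, is concentrated on a finite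
  set. Hence every continuous function is integrable and the convention that the integral of a
  non-integrable function is \<open>0\<close> plays no role.
\<close>

definition cW_monotone ::
    "nat \<Rightarrow> (nat \<Rightarrow> 'a topology) \<Rightarrow> ((nat \<Rightarrow> 'a) \<Rightarrow> real) \<Rightarrow> ((nat \<Rightarrow> 'a) \<Rightarrow> real) set
      \<Rightarrow> (nat \<Rightarrow> 'a) set \<Rightarrow> bool" where
  "cW_monotone n X c W \<Gamma> \<longleftrightarrow>
     \<Gamma> \<subseteq> topspace (prod_space n X) \<and>
     (\<forall>m. \<forall>S. S \<subseteq> \<Gamma> \<and> finite S \<and> card S = m \<longrightarrow>
       (\<forall>\<beta>. finite_borel (prod_space n X) \<beta> \<and> supp (prod_space n X) \<beta> = S \<longrightarrow>
         (\<forall>\<alpha>. finite_borel (prod_space n X) \<alpha> \<and> W_equivalent n X W \<alpha> \<beta> \<longrightarrow>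
           (\<integral>x. c x \<partial>\<beta>) \<le> (\<integral>x. c x \<partial>\<alpha>))))"

end

theory Submission
  imports Defs
begin

text \<open>
  The optimal plan has no duality gap: \<open>\<integral>c d\<pi>\<^sub>*\<close> is the supremum of \<open>\<Sum>i. \<integral>f\<^sub>i d\<mu>\<^sub>i\<close> over all
  \<open>\<mu>\<^sub>i\<close>-integrable \<open>f\<^sub>i\<close> and \<open>w \<in> W\<close> with \<open>\<Sum>i. f\<^sub>i \<circ> Pr\<^sub>i + w \<le> c\<close>. Along a maximizing sequence the
  nonnegative functions \<open>g\<^sub>j = c - \<Sum>i. f\<^sub>i \<circ> Pr\<^sub>i - w\<close> tend to \<open>0\<close> in \<open>L\<^sup>1(\<pi>\<^sub>*)\<close>, so a subsequence tends to
  \<open>0\<close> on a set \<open>\<Gamma>\<close> of full measure. If \<open>\<beta>\<close> is finitely supported in \<open>\<Gamma>\<close> and \<open>\<alpha> \<sim>\<^sub>W \<beta>\<close>, then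
  \<open>\<integral>c d\<beta> - \<integral>c d\<alpha> = \<integral>g\<^sub>j d\<beta> - \<integral>g\<^sub>j d\<alpha> \<le> \<integral>g\<^sub>j d\<beta> \<longlongrightarrow> 0\<close>.

  If there were a gap, Hahn-Banach would give a positive functional on the functions dominated by
  some \<open>\<Sum>i. f\<^sub>i \<circ> Pr\<^sub>i\<close> that has the marginals \<open>\<mu>\<^sub>i\<close>, vanishes on \<open>W\<close> and is smaller than \<open>\<integral>c d\<pi>\<^sub>*\<close> at \<open>c\<close>.
  Its values on indicators form a finitely additive set function whose marginals are tight, so it
  is countably additive on sets with good inner and outer compact approximations, and its
  Caratheodory extension is an admissible plan cheaper than \<open>\<pi>\<^sub>*\<close>.
\<close>

section \<open>The Hahn-Banach theorem\<close>

definition sublinear_on :: "('b \<Rightarrow> real) set \<Rightarrow> (('b \<Rightarrow> real) \<Rightarrow> real) \<Rightarrow> bool" where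
  "sublinear_on V q \<longleftrightarrow>
     (\<forall>u\<in>V. \<forall>v\<in>V. q (\<lambda>x. u x + v x) \<le> q u + q v) \<and>
     (\<forall>a\<ge>0. \<forall>u\<in>V. q (\<lambda>x. a * u x) = a * q u)"

definition linear_functional_on :: "('b \<Rightarrow> real) set \<Rightarrow> (('b \<Rightarrow> real) \<Rightarrow> real) \<Rightarrow> bool" where
  "linear_functional_on V L \<longleftrightarrow>
     (\<forall>u\<in>V. \<forall>v\<in>V. L (\<lambda>x. u x + v x) = L u + L v) \<and>
     (\<forall>a. \<forall>u\<in>V. L (\<lambda>x. a * u x) = a * L u)"

lemma function_subspace_UNIV_iff:
  "function_subspace UNIV V \<longleftrightarrow> (\<lambda>x. 0) \<in> V \<and>
     (\<forall>u\<in>V. \<forall>v\<in>V. (\<lambda>x. u x + v x) \<in> V) \<and> (\<forall>a. \<forall>u\<in>V. (\<lambda>x. a * u x) \<in> V)"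
  by (auto simp: function_subspace_def restrict_def)

locale sublinear_functional =
  fixes V :: "('b \<Rightarrow> real) set" and p :: "('b \<Rightarrow> real) \<Rightarrow> real"
  assumes subspace: "function_subspace UNIV V" and sublinear: "sublinear_on V p"
begin

lemma zero_mem: "(\<lambda>x. 0) \<in> V"
  and add_mem: "u \<in> V \<Longrightarrow> v \<in> V \<Longrightarrow> (\<lambda>x. u x + v x) \<in> V"
  and scale_mem: "u \<in> V \<Longrightarrow> (\<lambda>x. a * u x) \<in> V"
  using subspace by (auto simp: function_subspace_UNIV_iff)

lemma uminus_mem: "u \<in> V \<Longrightarrow> (\<lambda>x. - u x) \<in> V"
  using scale_mem[of u "-1"] by simp

lemma subadditive: "u \<in> V \<Longrightarrow> v \<in> V \<Longrightarrow> p (\<lambda>x. u x + v x) \<le> p u + p v"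
  and homogeneous: "a \<ge> 0 \<Longrightarrow> u \<in> V \<Longrightarrow> p (\<lambda>x. a * u x) = a * p u"
  using sublinear by (auto simp: sublinear_on_def)

lemma zero: "p (\<lambda>x. 0) = 0"
  using homogeneous[of 0 "\<lambda>x. 0"] zero_mem by simp

lemma minus_le: "u \<in> V \<Longrightarrow> - p (\<lambda>x. - u x) \<le> p u"
  using subadditive[of u "\<lambda>x. - u x"] uminus_mem[of u] zero by simp

text \<open>For \<open>a\<close> in \<open>V\<close> this is the largest sublinear functional below
  \<open>p\<close> whose value at the negative of \<open>a\<close> is at most
  \<open>- p a\<close>.\<close>

definition tilt :: "('b \<Rightarrow> real) \<Rightarrow> ('b \<Rightarrow> real) \<Rightarrow> real" where
  "tilt a u = (INF t\<in>{0..}. p (\<lambda>x. u x + t * a x) - t * p a)"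

text \<open>The bound does not involve \<open>t\<close>, so the infimum in \<open>tilt\<close> is
  taken over a set that is bounded below.\<close>

lemma tilt_lower_bound:
  assumes "a \<in> V" "u \<in> V" "t \<ge> 0"
  shows "- p (\<lambda>x. - u x) \<le> p (\<lambda>x. u x + t * a x) - t * p a"
proof -
  have "t * p a = p (\<lambda>x. (u x + t * a x) + - u x)"
    using homogeneous[of t a] assms by simp
  also have "\<dots> \<le> p (\<lambda>x. u x + t * a x) + p (\<lambda>x. - u x)"
    using assms by (intro subadditive add_mem scale_mem uminus_mem)
  finally show ?thesis by simp
qed

lemma tilt_le:
  assumes "a \<in> V" "u \<in> V" "t \<ge> 0"
  shows "tilt a u \<le> p (\<lambda>x. u x + t * a x) - t * p a"
  unfolding tilt_def
  by (rule cINF_lower) (use assms tilt_lower_bound in \<open>auto simp: bdd_below_def\<close>)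

lemma tilt_le_self: "a \<in> V \<Longrightarrow> u \<in> V \<Longrightarrow> tilt a u \<le> p u"
  using tilt_le[of a u 0] by simp

lemma le_tilt:
  assumes "\<And>t. t \<ge> 0 \<Longrightarrow> b \<le> p (\<lambda>x. u x + t * a x) - t * p a"
  shows "b \<le> tilt a u"
  unfolding tilt_def by (rule cINF_greatest) (use assms in auto)

text \<open>Parameters \<open>s\<close> for \<open>u\<close> and \<open>t\<close> for
  \<open>v\<close> combine to \<open>s + t\<close> for the sum, and the parameter \<open>t\<close>
  for \<open>s * u\<close> corresponds to \<open>t / s\<close> for \<open>u\<close>. One inequality
  for all positive factors suffices, because it can be applied to the inverse factor.\<close>

lemma sublinear_tilt:
  assumes a: "a \<in> V"
  shows "sublinear_on V (tilt a)"
proof -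
  have add: "tilt a (\<lambda>x. u x + v x) \<le> tilt a u + tilt a v" if u: "u \<in> V" and v: "v \<in> V" for u v
  proof -
    have *: "tilt a (\<lambda>x. u x + v x) \<le>
        (p (\<lambda>x. u x + s * a x) - s * p a) + (p (\<lambda>x. v x + t * a x) - t * p a)"
      if "s \<ge> 0" "t \<ge> 0" for s t
    proof -
      have "tilt a (\<lambda>x. u x + v x) \<le> p (\<lambda>x. (u x + v x) + (s + t) * a x) - (s + t) * p a"
        using u v a that by (intro tilt_le add_mem) auto
      also have "(\<lambda>x. (u x + v x) + (s + t) * a x) = (\<lambda>x. (u x + s * a x) + (v x + t * a x))"
        by (auto simp: algebra_simps)
      also have "p \<dots> \<le> p (\<lambda>x. u x + s * a x) + p (\<lambda>x. v x + t * a x)"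
        using u v a by (intro subadditive add_mem scale_mem)
      finally show ?thesis by (simp add: algebra_simps)
    qed
    have "tilt a (\<lambda>x. u x + v x) - (p (\<lambda>x. v x + t * a x) - t * p a) \<le> tilt a u" if "t \<ge> 0" for t
    proof (rule le_tilt)
      fix s :: real assume "s \<ge> 0"
      from *[OF this that] show "tilt a (\<lambda>x. u x + v x) - (p (\<lambda>x. v x + t * a x) - t * p a)
        \<le> p (\<lambda>x. u x + s * a x) - s * p a" by simp
    qed
    then have "tilt a (\<lambda>x. u x + v x) - tilt a u \<le> tilt a v"
      by (intro le_tilt) (simp add: algebra_simps)
    then show ?thesis by simp
  qed
  have zero': "tilt a (\<lambda>x. 0) = 0"
  proof (rule antisym)
    show "tilt a (\<lambda>x. 0) \<le> 0" using tilt_le_self[OF a zero_mem] zero by simp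
    show "0 \<le> tilt a (\<lambda>x. 0)"
      by (rule le_tilt) (use homogeneous[OF _ a] in simp)
  qed
  have scale_ge: "s * tilt a u \<le> tilt a (\<lambda>x. s * u x)" if u: "u \<in> V" and s: "s > 0" for s u
  proof (rule le_tilt)
    fix t :: real assume t: "t \<ge> 0"
    have "tilt a u \<le> p (\<lambda>x. u x + (t / s) * a x) - (t / s) * p a"
      using u a t s by (intro tilt_le) auto
    then have "s * tilt a u \<le> s * p (\<lambda>x. u x + (t / s) * a x) - t * p a"
      using s by (simp add: field_simps)
    also have "s * p (\<lambda>x. u x + (t / s) * a x) = p (\<lambda>x. s * (u x + (t / s) * a x))"
      using u a s by (intro homogeneous[symmetric] add_mem scale_mem) auto
    also have "(\<lambda>x. s * (u x + (t / s) * a x)) = (\<lambda>x. s * u x + t * a x)"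
      using s by (auto simp: field_simps)
    finally show "s * tilt a u \<le> p (\<lambda>x. s * u x + t * a x) - t * p a" .
  qed
  have "tilt a (\<lambda>x. s * u x) = s * tilt a u" if u: "u \<in> V" and s: "s \<ge> 0" for s u
  proof (cases "s = 0")
    case True
    then show ?thesis using zero' by simp
  next
    case False
    with s have s: "s > 0" by simp
    have "(1 / s) * tilt a (\<lambda>x. s * u x) \<le> tilt a (\<lambda>x. (1 / s) * (s * u x))"
      using scale_ge[OF scale_mem[OF u], of "1/s" s] s by simp
    then have "tilt a (\<lambda>x. s * u x) \<le> s * tilt a u"
      using s by (simp add: field_simps)
    with scale_ge[OF u s] show ?thesis by simp
  qed
  with add show ?thesis by (auto simp: sublinear_on_def)
qed

text \<open>Zorn's lemma for the sublinear functionals below \<open>p\<close>: the pointwise infimum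
  of a nonempty chain of them is again sublinear.\<close>

lemma ex_minimal_sublinear:
  obtains q where "sublinear_on V q" "\<And>u. u \<in> V \<Longrightarrow> q u \<le> p u"
    "\<And>q' u. sublinear_on V q' \<Longrightarrow> (\<And>u. u \<in> V \<Longrightarrow> q' u \<le> q u) \<Longrightarrow> u \<in> V \<Longrightarrow> q' u = q u"
proof -
  \<comment> \<open>Functionals are set to 0 outside \<open>V\<close>, so that an inequality on
    \<open>V\<close> becomes an inequality everywhere.\<close>
  define A where "A = {q. sublinear_on V q \<and> (\<forall>u\<in>V. q u \<le> p u) \<and> (\<forall>u. u \<notin> V \<longrightarrow> q u = 0)}"
  \<comment> \<open>The order is reversed: maximal elements for \<open>P\<close> are minimal
    functionals.\<close>
  define P where "P = (\<lambda>q q' :: ('b \<Rightarrow> real) \<Rightarrow> real. \<forall>u. q' u \<le> q u)"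
  define cut where "cut = (\<lambda>q u. if u \<in> V then q u else (0::real))"
  have cut: "sublinear_on V (cut q)" if "sublinear_on V q" for q
    using that add_mem scale_mem by (auto simp: sublinear_on_def cut_def)
  have po: "partial_order_on A (relation_of P A)"
    unfolding partial_order_on_def preorder_on_def
    by (auto simp: relation_of_def P_def refl_on_def trans_def antisym_def intro: order_trans
        intro!: ext antisym)
  have "\<exists>u\<in>A. \<forall>a\<in>C. P a u" if C: "C \<in> Chains (relation_of P A)" for C
  proof (cases "C = {}")
    case True
    then show ?thesis
      using cut[OF sublinear] by (intro bexI[of _ "cut p"]) (auto simp: A_def cut_def)
  next
    case False
    have CA: "q \<in> A" if "q \<in> C" for q using C that by (auto simp: Chains_def relation_of_def)
    have total: "P q q' \<or> P q' q" if "q \<in> C" "q' \<in> C" for q q'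
      using C that by (auto simp: Chains_def relation_of_def)
    \<comment> \<open>A lower bound common to all members of the chain makes the pointwise infimum
      meaningful.\<close>
    have lower: "- p (\<lambda>x. - u x) \<le> q u" if "u \<in> V" "q \<in> C" for u q
    proof -
      interpret q: sublinear_functional V q
        using CA[OF that(2)] subspace by unfold_locales (auto simp: A_def)
      have "q (\<lambda>x. - u x) \<le> p (\<lambda>x. - u x)"
        using CA[OF that(2)] uminus_mem[OF that(1)] by (auto simp: A_def)
      with q.minus_le[OF that(1)] show ?thesis by simp
    qed
    define i where "i = (\<lambda>u. INF q\<in>C. q u)"
    have i_le: "i u \<le> q u" if "u \<in> V" "q \<in> C" for u q
      unfolding i_def by (rule cINF_lower) (use that lower in \<open>auto simp: bdd_below_def\<close>)
    have le_i: "b \<le> i u" if "\<And>q. q \<in> C \<Longrightarrow> b \<le> q u" for b u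
      unfolding i_def by (rule cINF_greatest) (use that False in auto)
    have "sublinear_on V i"
      unfolding sublinear_on_def
    proof (intro conjI ballI allI impI)
      fix u v assume u: "u \<in> V" and v: "v \<in> V"
      have *: "i (\<lambda>x. u x + v x) \<le> q u + q' v" if q: "q \<in> C" "q' \<in> C" for q q'
      proof -
        \<comment> \<open>In a chain the smaller of \<open>q\<close> and \<open>q'\<close> can be
          used for both arguments, so its subadditivity passes to the infimum.\<close>
        obtain r where r: "r \<in> C" "r u \<le> q u" "r v \<le> q' v"
          using total[OF q] q unfolding P_def by blast
        have "i (\<lambda>x. u x + v x) \<le> r (\<lambda>x. u x + v x)" using r u v by (intro i_le add_mem)
        also have "\<dots> \<le> r u + r v" using CA[OF r(1)] u v by (auto simp: A_def sublinear_on_def)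
        finally show ?thesis using r by simp
      qed
      have "i (\<lambda>x. u x + v x) - q' v \<le> i u" if "q' \<in> C" for q'
        by (rule le_i) (use *[OF _ that] in \<open>simp add: algebra_simps\<close>)
      then have "i (\<lambda>x. u x + v x) - i u \<le> i v"
        by (intro le_i) (simp add: algebra_simps)
      then show "i (\<lambda>x. u x + v x) \<le> i u + i v" by simp
    next
      fix a :: real and u assume a: "a \<ge> 0" and u: "u \<in> V"
      have hom: "q (\<lambda>x. a * u x) = a * q u" if "q \<in> C" for q
        using CA[OF that] a u by (auto simp: A_def sublinear_on_def)
      show "i (\<lambda>x. a * u x) = a * i u"
      proof (rule antisym)
        show "a * i u \<le> i (\<lambda>x. a * u x)"
          by (rule le_i) (metis hom i_le[OF u] a mult_left_mono)
        show "i (\<lambda>x. a * u x) \<le> a * i u"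
        proof (cases "a = 0")
          case True
          then show ?thesis using i_le[OF zero_mem] False hom by fastforce
        next
          case a0: False
          have "i (\<lambda>x. a * u x) / a \<le> i u"
            by (rule le_i) (use hom i_le[OF scale_mem[OF u, of a]] a a0 in \<open>auto simp: field_simps\<close>)
          then show ?thesis using a a0 by (simp add: field_simps)
        qed
      qed
    qed
    moreover obtain q0 where "q0 \<in> C" using False by auto
    then have "i u \<le> p u" if "u \<in> V" for u
      using i_le[OF that, of q0] CA[of q0] that by (force simp: A_def)
    ultimately have "cut i \<in> A"
      using cut by (auto simp: A_def cut_def)
    moreover have "P q (cut i)" if "q \<in> C" for q
      using i_le[OF _ that] CA[OF that] by (auto simp: P_def cut_def A_def)
    ultimately show ?thesis by blast
  qed
  from predicate_Zorn[OF po this] obtain q where q: "q \<in> A" "\<And>r. r \<in> A \<Longrightarrow> P q r \<Longrightarrow> r = q"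
    by blast
  show thesis
  proof (rule that)
    show "sublinear_on V q" "\<And>u. u \<in> V \<Longrightarrow> q u \<le> p u" using q by (auto simp: A_def)
    fix q' u assume q': "sublinear_on V q'" "\<And>u. u \<in> V \<Longrightarrow> q' u \<le> q u" and u: "u \<in> V"
    have "cut q' \<in> A"
      using cut[OF q'(1)] q' q(1) by (force simp: A_def cut_def)
    moreover have "P q (cut q')" using q' q(1) by (auto simp: P_def cut_def A_def)
    ultimately have "cut q' = q" by (rule q(2))
    with u show "q' u = q u" by (auto simp: cut_def)
  qed
qed

text \<open>A minimal sublinear functional equals each of its tilts and is therefore additive.\<close>

lemma ex_linear_le:
  obtains L where "linear_functional_on V L" "\<And>u. u \<in> V \<Longrightarrow> L u \<le> p u"
proof -
  obtain q where q: "sublinear_on V q" "\<And>u. u \<in> V \<Longrightarrow> q u \<le> p u"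
    and minimal: "\<And>q' u. sublinear_on V q' \<Longrightarrow> (\<And>u. u \<in> V \<Longrightarrow> q' u \<le> q u) \<Longrightarrow> u \<in> V \<Longrightarrow> q' u = q u"
    using ex_minimal_sublinear by blast
  interpret q: sublinear_functional V q by unfold_locales (fact subspace q(1))+
  have add: "q (\<lambda>x. u x + v x) = q u + q v" if "u \<in> V" "v \<in> V" for u v
  proof (rule antisym)
    have "q u = q.tilt v u"
      using that by (intro minimal[symmetric] q.sublinear_tilt q.tilt_le_self)
    also have "\<dots> \<le> q (\<lambda>x. u x + v x) - q v" using q.tilt_le[of v u 1] that by simp
    finally show "q u + q v \<le> q (\<lambda>x. u x + v x)" by simp
  qed (use q.subadditive that in auto)
  have uminus: "q (\<lambda>x. - u x) = - q u" if "u \<in> V" for u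
    using add[OF that uminus_mem[OF that]] q.zero by simp
  have "q (\<lambda>x. a * u x) = a * q u" if u: "u \<in> V" for a u
  proof (cases "a \<ge> 0")
    case False
    have "q (\<lambda>x. a * u x) = q (\<lambda>x. - ((- a) * u x))" by simp
    also have "\<dots> = - ((- a) * q u)"
      using False u by (subst uminus[OF scale_mem[OF u]], subst q.homogeneous) auto
    finally show ?thesis by simp
  qed (use q.homogeneous u in auto)
  with add q(2) show thesis by (intro that[of q]) (auto simp: linear_functional_on_def)
qed

text \<open>A linear functional below \<open>tilt a\<close> is below \<open>p\<close> and is at most
  \<open>- p a\<close> at the negative of \<open>a\<close>; by linearity its value at
  \<open>a\<close> is then exactly \<open>p a\<close>.\<close>

theorem hahn_banach:
  assumes a: "a \<in> V"
  obtains L where "linear_functional_on V L" "\<And>u. u \<in> V \<Longrightarrow> L u \<le> p u" "L a = p a"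
proof -
  interpret t: sublinear_functional V "tilt a"
    by unfold_locales (intro subspace sublinear_tilt a)+
  obtain L where L: "linear_functional_on V L" "\<And>u. u \<in> V \<Longrightarrow> L u \<le> tilt a u"
    using t.ex_linear_le by blast
  have le: "L u \<le> p u" if "u \<in> V" for u using L(2) tilt_le_self[OF a] that by force
  have "L (\<lambda>x. - 1 * a x) = - 1 * L a" using L(1) a by (auto simp only: linear_functional_on_def)
  moreover have "L (\<lambda>x. - 1 * a x) \<le> - p a"
    using L(2)[OF uminus_mem[OF a]] tilt_le[OF a uminus_mem[OF a], of 1] zero by simp
  ultimately have "L a = p a" using le[OF a] by simp
  with L(1) le show thesis by (rule that)
qed

end

section \<open>Borel measures on Polish spaces\<close>

lemma space_borel_of [simp]: "space (borel_of T) = topspace T"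
  and sets_borel_of: "sets (borel_of T) = sigma_sets (topspace T) {U. openin T U}"
  unfolding borel_of_def
  by (subst space_measure_of sets_measure_of; auto dest: openin_subset)+

lemma openin_borel_of: "openin T U \<Longrightarrow> U \<in> sets (borel_of T)"
  by (simp add: sets_borel_of sigma_sets.Basic)

lemma closedin_borel_of:
  assumes "closedin T C"
  shows "C \<in> sets (borel_of T)"
proof -
  have "topspace T - (topspace T - C) \<in> sets (borel_of T)"
    using assms by (metis closedin_def openin_borel_of sets.compl_sets space_borel_of)
  with assms show ?thesis by (simp add: closedin_def double_diff)
qed

lemma measurable_borel_of:
  assumes "f \<in> space M \<rightarrow> topspace T" "\<And>U. openin T U \<Longrightarrow> f -` U \<inter> space M \<in> sets M"
  shows "f \<in> measurable M (borel_of T)"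
  unfolding borel_of_def
  by (rule measurable_measure_of) (use assms in \<open>auto dest: openin_subset\<close>)

lemma continuous_map_measurable_borel_of:
  assumes "continuous_map S T f"
  shows "f \<in> measurable (borel_of S) (borel_of T)"
proof (rule measurable_borel_of)
  fix U assume "openin T U"
  then have "openin S {x \<in> topspace S. f x \<in> U}" using assms by (simp add: continuous_map_def)
  moreover have "f -` U \<inter> space (borel_of S) = {x \<in> topspace S. f x \<in> U}" by auto
  ultimately show "f -` U \<inter> space (borel_of S) \<in> sets (borel_of S)" by (simp add: openin_borel_of)
qed (use assms in \<open>auto simp: continuous_map_def\<close>)

lemma continuous_map_borel_measurable:
  fixes f :: "'a \<Rightarrow> 'b::topological_space"
  assumes "continuous_map S euclidean f"
  shows "f \<in> borel_measurable (borel_of S)"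
proof -
  have "borel_of euclidean = (borel :: 'b measure)" by (simp add: borel_of_def borel_def)
  then show ?thesis using continuous_map_measurable_borel_of[OF assms] by simp
qed

section \<open>Countable bases of separable metrizable spaces and of finite products\<close>

lemma (in Metric_space) dense_mball:
  assumes "mtopology closure_of D = M" "x \<in> M" "e > 0"
  obtains q where "q \<in> D" "x \<in> mball q e"
proof -
  have "x \<in> mtopology closure_of D" using assms by simp
  with \<open>e > 0\<close> obtain q where "q \<in> D" "q \<in> mball x e" unfolding metric_closure_of by blast
  then show thesis by (intro that[of q]) (auto simp: commute)
qed

text \<open>The balls of radius \<open>1 / (r + 1)\<close> around the points of a countable dense
  set form a base.\<close>

lemma second_countable_separable_metrizable:
  assumes "separable_space X" "metrizable_space X"
  shows "second_countable X"
proof -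
  obtain M d where "Metric_space M d" and X: "X = Metric_space.mtopology M d"
    using assms(2) by (auto simp: metrizable_space_def)
  then interpret Metric_space M d by simp
  obtain D where D: "countable D" "D \<subseteq> M" "mtopology closure_of D = M"
    using assms(1) by (auto simp: separable_space_def X)
  define \<B> where "\<B> = (\<lambda>(q, r). mball q (1 / real (Suc r))) ` (D \<times> (UNIV :: nat set))"
  have "\<exists>V\<in>\<B>. x \<in> V \<and> V \<subseteq> U" if U: "openin mtopology U" and x: "x \<in> U" for U x
  proof -
    obtain e where e: "e > 0" "mball x e \<subseteq> U" and xM: "x \<in> M"
      using U x unfolding openin_mtopology by blast
    \<comment> \<open>With a radius below \<open>e / 2\<close>, a ball around \<open>q\<close> that
      contains \<open>x\<close> stays within distance \<open>e\<close> of \<open>x\<close>.\<close>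
    obtain r where r: "1 / real (Suc r) < e / 2"
      using nat_approx_posE[of "e/2"] e(1) by auto
    obtain q where q: "q \<in> D" "x \<in> mball q (1 / real (Suc r))"
      by (rule dense_mball[OF D(3) xM, of "1 / real (Suc r)"]) simp
    show ?thesis
    proof (intro bexI conjI)
      show "x \<in> mball q (1 / real (Suc r))" by fact
      show "mball q (1 / real (Suc r)) \<subseteq> U"
      proof
        fix y assume y: "y \<in> mball q (1 / real (Suc r))"
        then have "d x y \<le> d x q + d q y" using xM q by (intro triangle) auto
        also have "\<dots> < e / 2 + e / 2"
          using y q r by (intro add_strict_mono) (auto simp: commute simp del: of_nat_Suc)
        finally have "y \<in> mball x e" using xM y by simp
        with e show "y \<in> U" by blast
      qed
      show "mball q (1 / real (Suc r)) \<in> \<B>" using q unfolding \<B>_def by force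
    qed
  qed
  moreover have "countable \<B>" using D by (auto simp: \<B>_def)
  moreover have "openin mtopology V" if "V \<in> \<B>" for V using that by (auto simp: \<B>_def)
  ultimately show ?thesis unfolding second_countable_def X by blast
qed

text \<open>The base consists of boxes because the passage from a functional to a measure controls
  open boxes first and reaches other open sets as countable unions of them.\<close>

lemma ex_countable_box_base:
  assumes I: "finite I" and X: "\<forall>i\<in>I. second_countable (X i)"
  shows "\<exists>\<B>. countable \<B> \<and> (\<forall>R\<in>\<B>. \<exists>A. (\<forall>i\<in>I. openin (X i) (A i)) \<and> R = Pi\<^sub>E I A) \<and>
    (\<forall>U x. openin (product_topology X I) U \<and> x \<in> U \<longrightarrow> (\<exists>R\<in>\<B>. x \<in> R \<and> R \<subseteq> U))"
proof -
  have *: "\<forall>i\<in>I. \<exists>B. countable B \<and> (\<forall>V\<in>B. openin (X i) V) \<and>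
      (\<forall>U x. openin (X i) U \<and> x \<in> U \<longrightarrow> (\<exists>V\<in>B. x \<in> V \<and> V \<subseteq> U))"
    using X unfolding second_countable_def .
  from bchoice[OF *] obtain B where *: "\<forall>i\<in>I. countable (B i) \<and> (\<forall>V\<in>B i. openin (X i) V) \<and>
      (\<forall>U x. openin (X i) U \<and> x \<in> U \<longrightarrow> (\<exists>V\<in>B i. x \<in> V \<and> V \<subseteq> U))" ..
  then have B: "\<forall>i\<in>I. countable (B i)" "\<forall>i\<in>I. \<forall>V\<in>B i. openin (X i) V"
    "\<forall>i\<in>I. \<forall>U x. openin (X i) U \<and> x \<in> U \<longrightarrow> (\<exists>V\<in>B i. x \<in> V \<and> V \<subseteq> U)"
    by simp_all
  show ?thesis
  proof (intro exI[of _ "Pi\<^sub>E I ` (Pi\<^sub>E I B)"] conjI ballI allI impI)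
    show "countable (Pi\<^sub>E I ` (Pi\<^sub>E I B))"
      using I B(1) by (intro countable_image countable_PiE) auto
    show "\<exists>A. (\<forall>i\<in>I. openin (X i) (A i)) \<and> R = Pi\<^sub>E I A" if "R \<in> Pi\<^sub>E I ` (Pi\<^sub>E I B)" for R
      using that B(2) by (auto dest: PiE_mem)
    fix U x assume "openin (product_topology X I) U \<and> x \<in> U"
    then obtain A where A: "\<forall>i\<in>I. openin (X i) (A i)" "x \<in> Pi\<^sub>E I A" "Pi\<^sub>E I A \<subseteq> U"
      unfolding openin_product_topology_alt by blast
    have *: "\<forall>i\<in>I. \<exists>V. V \<in> B i \<and> x i \<in> V \<and> V \<subseteq> A i"
    proof
      fix i assume "i \<in> I"
      with A(1,2) have "openin (X i) (A i) \<and> x i \<in> A i" by auto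
      with B(3) \<open>i \<in> I\<close> show "\<exists>V. V \<in> B i \<and> x i \<in> V \<and> V \<subseteq> A i" by blast
    qed
    from bchoice[OF *] obtain V where V: "\<forall>i\<in>I. V i \<in> B i \<and> x i \<in> V i \<and> V i \<subseteq> A i" ..
    show "\<exists>R\<in>Pi\<^sub>E I ` (Pi\<^sub>E I B). x \<in> R \<and> R \<subseteq> U"
    proof (intro bexI conjI)
      \<comment> \<open>Restricting \<open>V\<close> to \<open>I\<close> makes it an element of
        \<open>Pi\<^sub>E I B\<close> and does not change the box.\<close>
      show "x \<in> Pi\<^sub>E I (restrict V I)" using V A(2) by (simp add: PiE_iff)
      have "Pi\<^sub>E I (restrict V I) \<subseteq> Pi\<^sub>E I A" using V by (intro PiE_mono) auto
      with A(3) show "Pi\<^sub>E I (restrict V I) \<subseteq> U" by blast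
      show "Pi\<^sub>E I (restrict V I) \<in> Pi\<^sub>E I ` (Pi\<^sub>E I B)" using V by (intro imageI) auto
    qed
  qed
qed

lemma second_countable_product_topology:
  assumes I: "finite I" and X: "\<forall>i\<in>I. second_countable (X i)"
  shows "second_countable (product_topology X I)"
proof -
  obtain \<B> where \<B>: "countable \<B>"
    "\<forall>R\<in>\<B>. \<exists>A. (\<forall>i\<in>I. openin (X i) (A i)) \<and> R = Pi\<^sub>E I A"
    "\<forall>U x. openin (product_topology X I) U \<and> x \<in> U \<longrightarrow> (\<exists>R\<in>\<B>. x \<in> R \<and> R \<subseteq> U)"
    using ex_countable_box_base[OF I X] by blast
  have "openin (product_topology X I) R" if "R \<in> \<B>" for R
  proof -
    from \<B>(2) that obtain A where "\<forall>i\<in>I. openin (X i) (A i)" "R = Pi\<^sub>E I A" by blast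
    then show ?thesis using I by (simp add: openin_PiE_gen)
  qed
  with \<B>(1,3) show ?thesis unfolding second_countable_def by blast
qed

section \<open>Compactness and tightness in Polish spaces\<close>

lemma polish_topology_facts:
  assumes "polish_topology X"
  shows "metrizable_space X" "Hausdorff_space X" "second_countable X"
  using assms completely_metrizable_imp_metrizable_space metrizable_imp_Hausdorff_space
    second_countable_separable_metrizable
  by (auto simp: polish_topology_def)

text \<open>Total boundedness asks for open balls centred in \<open>S\<close>. Closed balls with
  arbitrary centres suffice: every ball of radius \<open>e / 3\<close> that meets \<open>S\<close>
  is recentred at one of its points in \<open>S\<close>, which costs another
  \<open>e / 3\<close>.\<close>

lemma (in Metric_space) mtotally_boundedI:
  assumes "S \<subseteq> M" "\<And>e. e > 0 \<Longrightarrow> \<exists>K. finite K \<and> S \<subseteq> (\<Union>x\<in>K. mcball x e)"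
  shows "mtotally_bounded S"
  unfolding mtotally_bounded_def
proof (intro allI impI)
  fix e :: real assume e: "e > 0"
  then obtain K where K: "finite K" "S \<subseteq> (\<Union>x\<in>K. mcball x (e / 3))"
    using assms(2)[of "e/3"] by auto
  define K' where "K' = {x \<in> K. \<exists>y\<in>S. y \<in> mcball x (e / 3)}"
  have "\<exists>y. y \<in> S \<and> y \<in> mcball x (e / 3)" if "x \<in> K'" for x using that by (auto simp: K'_def)
  then obtain f where f: "\<And>x. x \<in> K' \<Longrightarrow> f x \<in> S" "\<And>x. x \<in> K' \<Longrightarrow> f x \<in> mcball x (e / 3)" by metis
  show "\<exists>K. finite K \<and> K \<subseteq> S \<and> S \<subseteq> (\<Union>x\<in>K. mball x e)"
  proof (intro exI conjI)
    show "finite (f ` K')" using K by (auto simp: K'_def)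
    show "f ` K' \<subseteq> S" using f by auto
    show "S \<subseteq> (\<Union>x\<in>f ` K'. mball x e)"
    proof
      fix y assume y: "y \<in> S"
      then obtain x where x: "x \<in> K" "y \<in> mcball x (e / 3)" using K by auto
      then have x': "x \<in> K'" using y by (auto simp: K'_def)
      have "d (f x) y \<le> d (f x) x + d x y" using f[OF x'] x y assms(1) by (intro triangle) auto
      also have "\<dots> \<le> e / 3 + e / 3" using f(2)[OF x'] x by (auto simp: commute)
      finally have "y \<in> mball (f x) e" using e f(1)[OF x'] y assms(1) by auto
      with x' show "y \<in> (\<Union>x\<in>f ` K'. mball x e)" by blast
    qed
  qed
qed

text \<open>For each \<open>m\<close>, finitely many closed balls of radius
  \<open>1 / (m + 1)\<close> around a dense sequence miss only a small part of the mass. The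
  intersection over \<open>m\<close> of these finite unions is closed and totally bounded, hence
  compact by completeness.\<close>

lemma Ulam_tight:
  assumes X: "polish_topology X" and M: "sets \<mu> = sets (borel_of X)" "finite_measure \<mu>" and e: "e > 0"
  obtains K where "compactin X K" "measure \<mu> (topspace X - K) < e"
proof -
  interpret finite_measure \<mu> by fact
  have space: "space \<mu> = topspace X" using sets_eq_imp_space_eq[OF M(1)] by simp
  obtain M d where "Metric_space M d" and mc: "Metric_space.mcomplete M d"
    and XM: "X = Metric_space.mtopology M d"
    using X by (auto simp: polish_topology_def completely_metrizable_space_def)
  then interpret Metric_space M d by simp
  obtain D where D: "countable D" "D \<subseteq> M" "mtopology closure_of D = M"
    using X by (auto simp: polish_topology_def separable_space_def XM)
  show thesis
  \<comment> \<open>A dense set can be enumerated by all natural numbers only if it is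
    nonempty.\<close>
  proof (cases "M = {}")
    case True
    then have "topspace X = {}" unfolding XM topspace_mtopology .
    then show ?thesis using e by (intro that[of "{}"]) auto
  next
    case False
    then have "D \<noteq> {}" using D by auto
    define q where "q = from_nat_into D"
    have qD: "range q = D" using D \<open>D \<noteq> {}\<close> by (simp add: q_def)
    have qM: "q j \<in> M" for j using D qD by auto
    define A where "A = (\<lambda>m k. \<Union>j\<le>k. mcball (q j) (1 / real (Suc m)))"
    have clA: "closedin mtopology (A m k)" for m k
      unfolding A_def by (intro closedin_Union) auto
    have AM: "A m k \<subseteq> M" for m k by (auto simp: A_def)
    have sA: "A m k \<in> sets \<mu>" for m k
      using closedin_borel_of[of X "A m k"] clA by (simp add: M XM)
    have sM: "M \<in> sets \<mu>" using sets.top[of \<mu>] by (simp add: space XM)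
    have lim: "(\<lambda>k. measure \<mu> (M - A m k)) \<longlonglongrightarrow> 0" for m
    proof -
      have inter: "(\<Inter>k. M - A m k) = {}"
      proof -
        have "\<exists>k. x \<in> A m k" if x: "x \<in> M" for x
        proof -
          obtain y where "y \<in> D" and y: "x \<in> mball y (1 / real (Suc m))"
            by (rule dense_mball[OF D(3) x, of "1 / real (Suc m)"]) simp
          then obtain j where "y = q j" using qD by blast
          then have "x \<in> mcball (q j) (1 / real (Suc m))" using y by (simp del: of_nat_Suc)
          then show ?thesis unfolding A_def by blast
        qed
        then show ?thesis by auto
      qed
      moreover have "decseq (\<lambda>k. M - A m k)"
        by (rule decseq_SucI) (auto simp: A_def)
      moreover have "range (\<lambda>k. M - A m k) \<subseteq> sets \<mu>" using sA sM by auto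
      ultimately show ?thesis
        using finite_Lim_measure_decseq[of "\<lambda>k. M - A m k"] unfolding inter by simp
    qed
    \<comment> \<open>These losses sum to \<open>e / 2\<close> over \<open>m\<close>, which leaves
      room for the strict inequality in the end.\<close>
    have "\<exists>k. measure \<mu> (M - A m k) < e / 4 * (1/2) ^ m" for m
    proof -
      have "eventually (\<lambda>k. measure \<mu> (M - A m k) < e / 4 * (1/2) ^ m) sequentially"
        using lim[of m] e by (intro order_tendstoD) auto
      then show ?thesis by (auto simp: eventually_sequentially)
    qed
    then obtain k where k: "\<And>m. measure \<mu> (M - A m (k m)) < e / 4 * (1/2) ^ m" by metis
    define K where "K = (\<Inter>m. A m (k m))"
    have KM: "K \<subseteq> M" using AM[of 0 "k 0"] by (auto simp: K_def)
    have clK: "closedin mtopology K" unfolding K_def by (intro closedin_Inter) (auto intro: clA)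
    have "mtotally_bounded K"
    proof (rule mtotally_boundedI[OF KM])
      fix e :: real assume "e > 0"
      then obtain m where m: "1 / real (Suc m) < e" using nat_approx_posE by metis
      show "\<exists>C. finite C \<and> K \<subseteq> (\<Union>x\<in>C. mcball x e)"
      proof (intro exI conjI)
        show "finite (q ` {..k m})" by simp
        have "K \<subseteq> A m (k m)" by (auto simp: K_def)
        also have "\<dots> \<subseteq> (\<Union>x\<in>q ` {..k m}. mcball x e)" using m by (fastforce simp: A_def)
        finally show "K \<subseteq> (\<Union>x\<in>q ` {..k m}. mcball x e)" .
      qed
    qed
    then have "compactin mtopology (mtopology closure_of K)"
      using mtotally_bounded_eq_compact_closure_of[OF mc] by blast
    then have "compactin X K" using clK by (simp add: XM closure_of_closedin)
    moreover have "measure \<mu> (topspace X - K) < e"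
    proof -
      have g: "summable (\<lambda>m. e / 4 * (1/2::real) ^ m)" by (intro summable_mult summable_geometric) simp
      have s: "summable (\<lambda>m. measure \<mu> (M - A m (k m)))"
        by (rule summable_comparison_test'[OF g, of 0]) (use k in \<open>auto intro: less_imp_le\<close>)
      have *: "topspace X - K = (\<Union>m. M - A m (k m))" by (auto simp: XM K_def)
      have "measure \<mu> (topspace X - K) \<le> (\<Sum>m. measure \<mu> (M - A m (k m)))"
        unfolding * by (rule finite_measure_subadditive_countably[OF _ s]) (use sA sM in auto)
      also have "\<dots> \<le> (\<Sum>m. e / 4 * (1/2) ^ m)"
        by (rule suminf_le[OF _ s g]) (use k in \<open>auto intro: less_imp_le\<close>)
      also have "\<dots> = e / 2" by (subst suminf_mult) (auto simp: suminf_geometric summable_geometric)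
      finally show ?thesis using e by simp
    qed
    ultimately show ?thesis by (rule that)
  qed
qed

text \<open>An open set in a metrizable space is an increasing union of closed sets. One of them
  exhausts \<open>U\<close> up to \<open>e / 2\<close>, and intersecting it with a compact set that
  carries all but \<open>e / 2\<close> of the total mass makes it compact.\<close>

lemma inner_regular_open_polish:
  assumes X: "polish_topology X" and M: "sets \<mu> = sets (borel_of X)" "finite_measure \<mu>"
    and U: "openin X U" and e: "e > 0"
  obtains K where "compactin X K" "K \<subseteq> U" "measure \<mu> (U - K) < e"
proof -
  interpret finite_measure \<mu> by fact
  obtain K where K: "compactin X K" "measure \<mu> (topspace X - K) < e / 2"
    using Ulam_tight[OF X M, of "e/2"] e by auto
  obtain C where C: "\<And>n. closedin X (C n)" "\<And>n. C n \<subseteq> C (Suc n)" "\<Union> (range C) = U"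
    using open_imp_fsigma_in[OF polish_topology_facts(1)[OF X] U] unfolding fsigma_in_ascending by blast
  have sC: "C n \<in> sets \<mu>" for n using C(1) closedin_borel_of M by blast
  have sU: "U \<in> sets \<mu>" using U openin_borel_of M by blast
  have sK: "K \<in> sets \<mu>"
    using compactin_imp_closedin[OF polish_topology_facts(2)[OF X] K(1)] closedin_borel_of M by blast
  have "(\<lambda>n. measure \<mu> (U - C n)) \<longlonglongrightarrow> measure \<mu> (\<Inter>n. U - C n)"
    using C(2) sC sU by (intro finite_Lim_measure_decseq decseq_SucI) auto
  moreover have inter: "(\<Inter>n. U - C n) = {}" using C(3) by auto
  ultimately have "(\<lambda>n. measure \<mu> (U - C n)) \<longlonglongrightarrow> 0" unfolding inter by simp
  then have "eventually (\<lambda>n. measure \<mu> (U - C n) < e / 2) sequentially"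
    using e by (intro order_tendstoD) auto
  then obtain n where n: "measure \<mu> (U - C n) < e / 2" by (auto simp: eventually_sequentially)
  show thesis
  proof (rule that)
    show "compactin X (C n \<inter> K)" using C(1) K(1) by (rule closed_Int_compactin)
    show "C n \<inter> K \<subseteq> U" using C(3) by auto
    have sT: "topspace X - K \<in> sets \<mu>"
      using sets.compl_sets[OF sK] sets_eq_imp_space_eq[OF M(1)] by simp
    have "measure \<mu> (U - C n \<inter> K) \<le> measure \<mu> ((U - C n) \<union> (topspace X - K))"
      using openin_subset[OF U] sU sC sT by (intro finite_measure_mono) auto
    also have "\<dots> \<le> measure \<mu> (U - C n) + measure \<mu> (topspace X - K)"
      using sU sC sT by (intro measure_Un_le) auto
    finally show "measure \<mu> (U - C n \<inter> K) < e" using n K by simp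
  qed
qed

section \<open>Finitely additive set functions with compact approximations\<close>

text \<open>The function \<open>\<nu>\<close> is additive on all subsets of the carrier, as the
  values of a functional on indicators are. Countable additivity is sought only on an algebra of
  sets with compact approximations.\<close>

locale finitely_additive =
  fixes T :: "'b topology" and \<nu> :: "'b set \<Rightarrow> real"
  assumes Hausdorff: "Hausdorff_space T"
    and nonneg: "A \<subseteq> topspace T \<Longrightarrow> 0 \<le> \<nu> A"
    and additive: "A \<subseteq> topspace T \<Longrightarrow> B \<subseteq> topspace T \<Longrightarrow> A \<inter> B = {} \<Longrightarrow> \<nu> (A \<union> B) = \<nu> A + \<nu> B"
begin

lemma empty: "\<nu> {} = 0"
  using additive[of "{}" "{}"] by simp

lemma mono:
  assumes "A \<subseteq> B" "B \<subseteq> topspace T"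
  shows "\<nu> A \<le> \<nu> B"
proof -
  have "\<nu> (A \<union> (B - A)) = \<nu> A + \<nu> (B - A)" using assms by (intro additive) auto
  moreover have "A \<union> (B - A) = B" using assms by auto
  moreover have "0 \<le> \<nu> (B - A)" using assms by (intro nonneg) auto
  ultimately show ?thesis by simp
qed

lemma subadditive:
  assumes "A \<subseteq> topspace T" "B \<subseteq> topspace T"
  shows "\<nu> (A \<union> B) \<le> \<nu> A + \<nu> B"
proof -
  have "\<nu> (A \<union> (B - A)) = \<nu> A + \<nu> (B - A)" using assms by (intro additive) auto
  moreover have "\<nu> (B - A) \<le> \<nu> B" using assms by (intro mono) auto
  ultimately show ?thesis by simp
qed

lemma subadditive_finite:
  assumes "finite I" "\<And>i. i \<in> I \<Longrightarrow> A i \<subseteq> topspace T"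
  shows "\<nu> (\<Union>i\<in>I. A i) \<le> (\<Sum>i\<in>I. \<nu> (A i))"
  using assms
proof (induction I rule: finite_induct)
  case (insert i I)
  have "\<nu> (A i \<union> (\<Union>i\<in>I. A i)) \<le> \<nu> (A i) + \<nu> (\<Union>i\<in>I. A i)"
    using insert.prems by (intro subadditive) auto
  with insert show ?case by fastforce
qed (simp add: empty)

text \<open>The condition treats a set and its complement symmetrically. For the whole space
  \<open>D\<close> is empty and the condition is tightness of \<open>\<nu>\<close>.\<close>

definition approximable :: "'b set set" where
  "approximable = {A. A \<subseteq> topspace T \<and>
     (\<forall>e>0. \<exists>C D. compactin T C \<and> C \<subseteq> A \<and> compactin T D \<and> D \<inter> A = {} \<and> \<nu> (topspace T - (C \<union> D)) < e)}"

lemma approximableD: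
  assumes "A \<in> approximable" "e > 0"
  obtains C D where "compactin T C" "C \<subseteq> A" "compactin T D" "D \<inter> A = {}"
    "\<nu> (topspace T - (C \<union> D)) < e"
  using assms unfolding approximable_def by blast

text \<open>Complements exchange \<open>C\<close> and \<open>D\<close>. A union uses
  \<open>C \<union> C'\<close> and \<open>D \<inter> D'\<close>: what they leave uncovered lies in
  the union of the two sets left uncovered before.\<close>

lemma algebra_approximable:
  assumes "topspace T \<in> approximable"
  shows "algebra (topspace T) approximable"
  unfolding algebra_iff_Un
proof (intro conjI ballI)
  show "approximable \<subseteq> Pow (topspace T)" by (auto simp: approximable_def)
  have compl: "topspace T - A \<in> approximable" if A: "A \<in> approximable" for A
    unfolding approximable_def
  proof (intro CollectI conjI allI impI)
    fix e :: real assume "e > 0"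
    then obtain C D where "compactin T C" "C \<subseteq> A" "compactin T D" "D \<inter> A = {}"
      "\<nu> (topspace T - (C \<union> D)) < e"
      using approximableD[OF A] by blast
    then show "\<exists>C D. compactin T C \<and> C \<subseteq> topspace T - A \<and> compactin T D \<and> D \<inter> (topspace T - A) = {} \<and>
        \<nu> (topspace T - (C \<union> D)) < e"
      using compactin_subset_topspace[of T D]
      by (intro exI[of _ D] exI[of _ C]) (auto simp: Un_commute)
  qed auto
  then show "\<And>A. A \<in> approximable \<Longrightarrow> topspace T - A \<in> approximable" .
  show "{} \<in> approximable" using compl[OF assms] by simp
  fix A B assume A: "A \<in> approximable" and B: "B \<in> approximable"
  show "A \<union> B \<in> approximable"
    unfolding approximable_def
  proof (intro CollectI conjI allI impI)
    fix e :: real assume "e > 0"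
    then have e: "e / 2 > 0" by simp
    obtain C D where CD: "compactin T C" "C \<subseteq> A" "compactin T D" "D \<inter> A = {}"
      "\<nu> (topspace T - (C \<union> D)) < e / 2"
      using approximableD[OF A e] by blast
    obtain C' D' where CD': "compactin T C'" "C' \<subseteq> B" "compactin T D'" "D' \<inter> B = {}"
      "\<nu> (topspace T - (C' \<union> D')) < e / 2"
      using approximableD[OF B e] by blast
    have "\<nu> (topspace T - ((C \<union> C') \<union> (D \<inter> D'))) \<le>
        \<nu> ((topspace T - (C \<union> D)) \<union> (topspace T - (C' \<union> D')))"
      by (intro mono) auto
    also have "\<dots> \<le> \<nu> (topspace T - (C \<union> D)) + \<nu> (topspace T - (C' \<union> D'))"
      by (intro subadditive) auto
    finally have "\<nu> (topspace T - ((C \<union> C') \<union> (D \<inter> D'))) < e" using CD CD' by simp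
    moreover have "compactin T (C \<union> C')" using CD CD' by (intro compactin_Un)
    moreover have "compactin T (D \<inter> D')"
      using CD CD' compactin_imp_closedin[OF Hausdorff] by (intro compact_Int_closedin)
    ultimately show "\<exists>C D. compactin T C \<and> C \<subseteq> A \<union> B \<and> compactin T D \<and> D \<inter> (A \<union> B) = {} \<and>
        \<nu> (topspace T - (C \<union> D)) < e"
      using CD(2,4) CD'(2,4) by (intro exI[of _ "C \<union> C'"] exI[of _ "D \<inter> D'"]) auto
  qed (use A B in \<open>auto simp: approximable_def\<close>)
qed

text \<open>As for any compact class, a decreasing sequence of sets with large compact subsets and empty
  intersection leads to finitely many of these compact subsets with empty intersection.\<close>

lemma approximable_continuous_at_empty:
  assumes A: "range A \<subseteq> approximable" "decseq A" "(\<Inter>i. A i) = {}"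
  shows "(\<lambda>i. \<nu> (A i)) \<longlonglongrightarrow> 0"
proof (rule LIMSEQ_I)
  fix e :: real assume e: "e > 0"
  have AT: "A i \<subseteq> topspace T" for i using A(1) by (auto simp: approximable_def)
  have "\<exists>C. compactin T C \<and> C \<subseteq> A i \<and> \<nu> (A i - C) < e / 4 * (1/2) ^ i" for i
  proof -
    have Ai: "A i \<in> approximable" and ei: "e / 4 * (1/2) ^ i > 0" using A(1) e by auto
    obtain C D where CD: "compactin T C" "C \<subseteq> A i" "compactin T D" "D \<inter> A i = {}"
      "\<nu> (topspace T - (C \<union> D)) < e / 4 * (1/2) ^ i"
      using approximableD[OF Ai ei] by blast
    \<comment> \<open>As \<open>D\<close> is disjoint from \<open>A i\<close>, the part of
      \<open>A i\<close> outside \<open>C\<close> is also outside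
      \<open>C \<union> D\<close>.\<close>
    have "\<nu> (A i - C) \<le> \<nu> (topspace T - (C \<union> D))" using AT CD by (intro mono) auto
    also note CD(5)
    finally show ?thesis using CD(1,2) by blast
  qed
  then obtain C where C: "\<And>i. compactin T (C i)" "\<And>i. C i \<subseteq> A i"
    "\<And>i. \<nu> (A i - C i) < e / 4 * (1/2) ^ i" by metis
  \<comment> \<open>If all finite subfamilies met inside the compact set \<open>C 0\<close>, the
    closed sets \<open>C i\<close> would have a common point, which would lie in every
    \<open>A i\<close>.\<close>
  have "\<exists>F. finite F \<and> F \<subseteq> range C \<and> C 0 \<inter> \<Inter>F = {}"
  proof (rule ccontr)
    assume "\<not> ?thesis"
    moreover have "\<forall>K\<in>range C. closedin T K"
      using C(1) compactin_imp_closedin[OF Hausdorff] by auto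
    ultimately have "C 0 \<inter> \<Inter>(range C) \<noteq> {}"
      using C(1)[of 0] unfolding compactin_fip by blast
    then obtain x where "x \<in> C i" for i by auto
    with C(2) have "x \<in> (\<Inter>i. A i)" by (intro INT_I) (rule subsetD)
    with A(3) show False by simp
  qed
  then obtain J where J: "finite J" "C 0 \<inter> (\<Inter>i\<in>J. C i) = {}"
    by (metis finite_subset_image)
  \<comment> \<open>The index 0 is added because \<open>C 0\<close> takes part in the empty
    intersection.\<close>
  define N where "N = Max (insert 0 J)"
  have N: "i \<le> N" if "i \<in> insert 0 J" for i unfolding N_def using J(1) that by (intro Max_ge) auto
  \<comment> \<open>A point of \<open>A N\<close> misses some \<open>C i\<close> with
    \<open>i \<le> N\<close>, but it belongs to \<open>A i\<close> because the sequence
    decreases.\<close>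
  have "A N \<subseteq> (\<Union>i\<in>insert 0 J. A i - C i)"
  proof
    fix x assume x: "x \<in> A N"
    obtain i where i: "i \<in> insert 0 J" "x \<notin> C i" using J(2) by auto
    with N[OF i(1)] x A(2) show "x \<in> (\<Union>i\<in>insert 0 J. A i - C i)" by (auto simp: decseq_def)
  qed
  then have "\<nu> (A N) \<le> \<nu> (\<Union>i\<in>insert 0 J. A i - C i)" using AT by (intro mono) auto
  also have "\<dots> \<le> (\<Sum>i\<in>insert 0 J. \<nu> (A i - C i))"
    using AT J(1) by (intro subadditive_finite) auto
  also have "\<dots> \<le> (\<Sum>i\<in>insert 0 J. e / 4 * (1/2) ^ i)"
    using C(3) by (intro sum_mono) (auto intro: less_imp_le)
  also have "\<dots> \<le> (\<Sum>i. e / 4 * (1/2) ^ i)"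
    using J(1) e by (intro sum_le_suminf summable_mult summable_geometric) auto
  also have "\<dots> = e / 2" by (subst suminf_mult) (auto simp: suminf_geometric summable_geometric)
  finally have "\<nu> (A N) < e" using e by simp
  moreover have "\<nu> (A i) \<le> \<nu> (A N)" if "i \<ge> N" for i
    using A(2) that AT by (intro mono) (auto simp: decseq_def)
  ultimately show "\<exists>N. \<forall>i\<ge>N. norm (\<nu> (A i) - 0) < e"
    using nonneg[OF AT] by (intro exI[of _ N]) (auto intro: le_less_trans)
qed

text \<open>For a finite content on an algebra, continuity at the empty set gives countable
  additivity, so Caratheodory's theorem applies.\<close>

lemma ex_measure_extension:
  assumes T: "topspace T \<in> approximable"
  shows "\<exists>M. space M = topspace T \<and> sets M = sigma_sets (topspace T) approximable \<and>
    (\<forall>A\<in>approximable. emeasure M A = ennreal (\<nu> A))"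
proof -
  interpret algebra "topspace T" approximable by (rule algebra_approximable[OF T])
  have sub: "A \<subseteq> topspace T" if "A \<in> approximable" for A using that by (simp add: approximable_def)
  have "\<exists>\<mu>. (\<forall>s\<in>approximable. \<mu> s = ennreal (\<nu> s)) \<and>
      measure_space (topspace T) (sigma_sets (topspace T) approximable) \<mu>"
  proof (rule caratheodory_empty_continuous)
    show "positive approximable (\<lambda>s. ennreal (\<nu> s))" by (simp add: positive_def empty)
    show "additive approximable (\<lambda>s. ennreal (\<nu> s))"
      unfolding additive_def
    proof (intro ballI impI)
      fix A B assume "A \<in> approximable" "B \<in> approximable" "A \<inter> B = {}"
      with sub nonneg show "ennreal (\<nu> (A \<union> B)) = ennreal (\<nu> A) + ennreal (\<nu> B)"
        by (subst additive) auto
    qed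
    fix A :: "nat \<Rightarrow> 'b set" assume A: "range A \<subseteq> approximable" "decseq A" "(\<Inter>i. A i) = {}"
    have "(\<lambda>i. ennreal (\<nu> (A i))) \<longlonglongrightarrow> ennreal 0"
      by (rule tendsto_ennrealI[OF approximable_continuous_at_empty[OF A]])
    then show "(\<lambda>i. ennreal (\<nu> (A i))) \<longlonglongrightarrow> 0" by simp
  qed simp
  then obtain \<mu> where \<mu>: "\<And>s. s \<in> approximable \<Longrightarrow> \<mu> s = ennreal (\<nu> s)"
    "measure_space (topspace T) (sigma_sets (topspace T) approximable) \<mu>" by blast
  define M where "M = measure_of (topspace T) approximable \<mu>"
  have sets: "sets M = sigma_sets (topspace T) approximable" and space: "space M = topspace T"
    unfolding M_def using sub by (intro sets_measure_of space_measure_of; blast)+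
  have "emeasure M A = ennreal (\<nu> A)" if "A \<in> approximable" for A
  proof -
    have "emeasure M A = \<mu> A"
    proof (rule emeasure_measure_of[OF M_def])
      show "positive (sets M) \<mu>" "countably_additive (sets M) \<mu>"
        using \<mu>(2) by (simp_all add: measure_space_def sets)
      show "A \<in> sets M" using that by (simp add: sets)
    qed (use sub in auto)
    with \<mu>(1)[OF that] show ?thesis by simp
  qed
  with sets space show ?thesis by blast
qed

end

section \<open>Positive functionals with given marginals\<close>

locale polish_marginals =
  fixes I :: "'i set" and X :: "'i \<Rightarrow> 'a topology" and \<mu> :: "'i \<Rightarrow> 'a measure"
  assumes finite_index: "finite I" and nonempty_index: "I \<noteq> {}"
    and polish: "i \<in> I \<Longrightarrow> polish_topology (X i)"
    and borel_prob_marginal: "i \<in> I \<Longrightarrow> borel_prob (X i) (\<mu> i)"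
begin

abbreviation T :: "('i \<Rightarrow> 'a) topology" where "T \<equiv> product_topology X I"

declare topspace_product_topology [simp del]

lemma sets_marginal: "i \<in> I \<Longrightarrow> sets (\<mu> i) = sets (borel_of (X i))"
  and prob_space_marginal: "i \<in> I \<Longrightarrow> prob_space (\<mu> i)"
  using borel_prob_marginal by (auto simp: borel_prob_def)

lemma finite_measure_marginal: "i \<in> I \<Longrightarrow> finite_measure (\<mu> i)"
  using prob_space_marginal by (simp add: prob_space_def)

lemma Hausdorff_product: "Hausdorff_space T"
  using polish_topology_facts(2)[OF polish] by (simp add: Hausdorff_space_product_topology)

lemma second_countable_product: "second_countable T"
  using finite_index polish_topology_facts(3)[OF polish] by (intro second_countable_product_topology) auto

lemma coordinate_in_topspace: "x \<in> topspace T \<Longrightarrow> i \<in> I \<Longrightarrow> x i \<in> topspace (X i)"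
  by (auto simp: topspace_product_topology)

lemma measurable_coordinate: "i \<in> I \<Longrightarrow> (\<lambda>x. x i) \<in> measurable (borel_of T) (borel_of (X i))"
  by (intro continuous_map_measurable_borel_of continuous_map_product_projection)

text \<open>Neither continuity nor measurability is asked of \<open>h\<close>, so indicators of
  arbitrary sets belong to the space on which the Hahn-Banach functional is defined.\<close>

definition dominated :: "(('i \<Rightarrow> 'a) \<Rightarrow> real) set" where
  "dominated = {h. \<exists>f. (\<forall>i\<in>I. integrable (\<mu> i) (f i)) \<and>
     (\<forall>x\<in>topspace T. \<bar>h x\<bar> \<le> (\<Sum>i\<in>I. f i (x i)))}"

lemma dominatedI:
  assumes "\<And>i. i \<in> I \<Longrightarrow> integrable (\<mu> i) (f i)"
    "\<And>x. x \<in> topspace T \<Longrightarrow> \<bar>h x\<bar> \<le> (\<Sum>i\<in>I. f i (x i))"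
  shows "h \<in> dominated"
  using assms by (auto simp: dominated_def)

lemma dominatedE:
  assumes "h \<in> dominated"
  obtains f where "\<forall>i\<in>I. integrable (\<mu> i) (f i)" "\<forall>i\<in>I. \<forall>y. 0 \<le> f i y"
    "\<forall>x\<in>topspace T. \<bar>h x\<bar> \<le> (\<Sum>i\<in>I. f i (x i))"
proof -
  obtain f where f: "\<forall>i\<in>I. integrable (\<mu> i) (f i)"
    "\<forall>x\<in>topspace T. \<bar>h x\<bar> \<le> (\<Sum>i\<in>I. f i (x i))"
    using assms by (auto simp: dominated_def)
  have "\<bar>h x\<bar> \<le> (\<Sum>i\<in>I. \<bar>f i (x i)\<bar>)" if "x \<in> topspace T" for x
    using f(2) that by (intro order_trans[OF bspec[OF f(2) that] sum_mono]) auto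
  with f(1) show thesis by (intro that[of "\<lambda>i y. \<bar>f i y\<bar>"]) auto
qed

lemma add_dominated:
  assumes "u \<in> dominated" "v \<in> dominated"
  shows "(\<lambda>x. u x + v x) \<in> dominated"
proof -
  from assms obtain f g where "\<forall>i\<in>I. integrable (\<mu> i) (f i)" "\<forall>i\<in>I. integrable (\<mu> i) (g i)"
    and *: "\<And>x. x \<in> topspace T \<Longrightarrow> \<bar>u x\<bar> \<le> (\<Sum>i\<in>I. f i (x i))"
      "\<And>x. x \<in> topspace T \<Longrightarrow> \<bar>v x\<bar> \<le> (\<Sum>i\<in>I. g i (x i))"
    unfolding dominated_def by auto
  then show ?thesis
    by (intro dominatedI[of "\<lambda>i y. f i y + g i y"])
       (auto simp: sum.distrib intro!: order_trans[OF abs_triangle_ineq add_mono] *)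
qed

lemma scale_dominated:
  assumes "u \<in> dominated"
  shows "(\<lambda>x. a * u x) \<in> dominated"
proof -
  from assms obtain f where "\<forall>i\<in>I. integrable (\<mu> i) (f i)"
    and *: "\<And>x. x \<in> topspace T \<Longrightarrow> \<bar>u x\<bar> \<le> (\<Sum>i\<in>I. f i (x i))"
    unfolding dominated_def by auto
  then show ?thesis
    by (intro dominatedI[of "\<lambda>i y. \<bar>a\<bar> * f i y"])
       (auto simp: abs_mult sum_distrib_left[symmetric] intro!: mult_left_mono *)
qed

lemma diff_dominated:
  assumes "u \<in> dominated" "v \<in> dominated"
  shows "(\<lambda>x. u x - v x) \<in> dominated"
  using add_dominated[OF assms(1) scale_dominated[OF assms(2), of "-1"]] by simp

lemma coordinate_dominated:
  assumes i: "i \<in> I" and f: "integrable (\<mu> i) f"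
  shows "(\<lambda>x. f (x i)) \<in> dominated"
proof (rule dominatedI)
  show "integrable (\<mu> j) (\<lambda>y. if j = i then \<bar>f y\<bar> else 0)" if "j \<in> I" for j
    using f by (cases "j = i") auto
  show "\<bar>f (x i)\<bar> \<le> (\<Sum>j\<in>I. if j = i then \<bar>f (x j)\<bar> else 0)" for x :: "'i \<Rightarrow> 'a"
    using i finite_index by (simp add: sum.delta)
qed

lemma const_dominated: "(\<lambda>x. a) \<in> dominated"
proof -
  obtain i where i: "i \<in> I" using nonempty_index by auto
  interpret prob_space "\<mu> i" by (rule prob_space_marginal[OF i])
  show ?thesis using coordinate_dominated[OF i, of "\<lambda>_. a"] by simp
qed

lemma dominated_mono:
  assumes v: "v \<in> dominated" and le: "\<And>x. x \<in> topspace T \<Longrightarrow> \<bar>u x\<bar> \<le> \<bar>v x\<bar>"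
  shows "u \<in> dominated"
  using v le unfolding dominated_def by (blast intro: order_trans)

lemma indicator_dominated: "indicator A \<in> dominated"
  by (rule dominated_mono[OF const_dominated[of 1]]) (simp add: indicator_def)

lemma function_subspace_dominated: "function_subspace UNIV dominated"
  by (simp add: function_subspace_UNIV_iff const_dominated add_dominated scale_dominated)

lemma integral_coordinate:
  fixes f :: "'a \<Rightarrow> real"
  assumes \<pi>: "sets \<pi> = sets (borel_of T)" "distr \<pi> (borel_of (X i)) (\<lambda>x. x i) = \<mu> i"
    and i: "i \<in> I" and f: "integrable (\<mu> i) f"
  shows "integrable \<pi> (\<lambda>x. f (x i))" "(\<integral>x. f (x i) \<partial>\<pi>) = (\<integral>y. f y \<partial>\<mu> i)"
proof -
  have m: "(\<lambda>x. x i) \<in> measurable \<pi> (borel_of (X i))"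
    using measurable_coordinate[OF i] by (simp add: measurable_cong_sets[OF \<pi>(1) refl])
  have f': "f \<in> borel_measurable (borel_of (X i))"
    using f by (simp add: borel_measurable_integrable measurable_cong_sets[OF sets_marginal[OF i, symmetric] refl])
  show "integrable \<pi> (\<lambda>x. f (x i))"
    using f integrable_distr_eq[OF m f'] by (simp add: \<pi>(2))
  show "(\<integral>x. f (x i) \<partial>\<pi>) = (\<integral>y. f y \<partial>\<mu> i)"
    unfolding \<pi>(2)[symmetric] by (rule integral_distr[OF m f', symmetric])
qed

lemma integrable_dominated:
  assumes \<pi>: "sets \<pi> = sets (borel_of T)" "\<And>i. i \<in> I \<Longrightarrow> distr \<pi> (borel_of (X i)) (\<lambda>x. x i) = \<mu> i"
    and h: "h \<in> dominated" "h \<in> borel_measurable (borel_of T)"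
  shows "integrable \<pi> h"
proof -
  obtain f where f: "\<forall>i\<in>I. integrable (\<mu> i) (f i)" "\<forall>i\<in>I. \<forall>y. 0 \<le> f i y"
    "\<forall>x\<in>topspace T. \<bar>h x\<bar> \<le> (\<Sum>i\<in>I. f i (x i))"
    using dominatedE[OF h(1)] by blast
  show ?thesis
  proof (rule Bochner_Integration.integrable_bound)
    show "integrable \<pi> (\<lambda>x. \<Sum>i\<in>I. f i (x i))"
      using f(1) \<pi> by (intro Bochner_Integration.integrable_sum integral_coordinate(1)) auto
    show "h \<in> borel_measurable \<pi>" using h(2) by (simp add: measurable_cong_sets[OF \<pi>(1) refl])
    have "space \<pi> = topspace T" using sets_eq_imp_space_eq[OF \<pi>(1)] by simp
    then show "AE x in \<pi>. norm (h x) \<le> norm (\<Sum>i\<in>I. f i (x i))"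
      using f(3) by (intro AE_I2) force
  qed
qed

end

section \<open>The set function and the Borel measure of a positive functional\<close>

locale positive_functional = polish_marginals I X \<mu>
  for I :: "'i set" and X :: "'i \<Rightarrow> 'a topology" and \<mu> :: "'i \<Rightarrow> 'a measure" +
  fixes L :: "(('i \<Rightarrow> 'a) \<Rightarrow> real) \<Rightarrow> real"
  assumes linear: "linear_functional_on dominated L"
    and positive: "h \<in> dominated \<Longrightarrow> (\<And>x. x \<in> topspace T \<Longrightarrow> 0 \<le> h x) \<Longrightarrow> 0 \<le> L h"
    and marginals: "i \<in> I \<Longrightarrow> integrable (\<mu> i) f \<Longrightarrow> L (\<lambda>x. f (x i)) = (\<integral>y. f y \<partial>\<mu> i)"
begin

lemma L_add: "u \<in> dominated \<Longrightarrow> v \<in> dominated \<Longrightarrow> L (\<lambda>x. u x + v x) = L u + L v"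
  and L_scale: "u \<in> dominated \<Longrightarrow> L (\<lambda>x. a * u x) = a * L u"
  using linear by (auto simp: linear_functional_on_def)

lemma L_diff: "u \<in> dominated \<Longrightarrow> v \<in> dominated \<Longrightarrow> L (\<lambda>x. u x - v x) = L u - L v"
  using L_add[of u "\<lambda>x. -1 * v x"] L_scale[of v "-1"] scale_dominated[of v "-1"] by simp

lemma L_mono:
  assumes "u \<in> dominated" "v \<in> dominated" "\<And>x. x \<in> topspace T \<Longrightarrow> u x \<le> v x"
  shows "L u \<le> L v"
  using positive[of "\<lambda>x. v x - u x"] diff_dominated[of v u] L_diff[of v u] assms by simp

text \<open>Dominated functions are defined on the whole type, while positivity tests only points of
  the product; hence values elsewhere do not affect \<open>L\<close>.\<close>

lemma L_cong:
  assumes "u \<in> dominated" "v \<in> dominated" "\<And>x. x \<in> topspace T \<Longrightarrow> u x = v x"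
  shows "L u = L v"
  using assms by (intro antisym L_mono) auto

definition \<nu> :: "('i \<Rightarrow> 'a) set \<Rightarrow> real" where "\<nu> A = L (indicator A)"

sublocale \<nu>: finitely_additive T \<nu>
proof
  fix A B :: "('i \<Rightarrow> 'a) set" assume "A \<inter> B = {}"
  then have "indicator (A \<union> B) = (\<lambda>x. indicator A x + indicator B x :: real)"
    by (auto simp: indicator_def intro!: ext)
  then show "\<nu> (A \<union> B) = \<nu> A + \<nu> B"
    unfolding \<nu>_def by (simp add: L_add indicator_dominated)
qed (auto simp: \<nu>_def Hausdorff_product intro: positive indicator_dominated)

abbreviation cylinder :: "'i \<Rightarrow> 'a set \<Rightarrow> ('i \<Rightarrow> 'a) set" where
  "cylinder i A \<equiv> {x \<in> topspace T. x i \<in> A}"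

lemma \<nu>_cylinder:
  assumes i: "i \<in> I" and A: "A \<in> sets (\<mu> i)"
  shows "\<nu> (cylinder i A) = measure (\<mu> i) A"
proof -
  interpret prob_space "\<mu> i" by (rule prob_space_marginal[OF i])
  have int: "integrable (\<mu> i) (indicator A :: 'a \<Rightarrow> real)"
    by (rule integrable_real_indicator[OF A]) (simp add: less_top[symmetric])
  have "\<nu> (cylinder i A) = L (\<lambda>x. indicator A (x i))"
    unfolding \<nu>_def
    by (rule L_cong[OF indicator_dominated coordinate_dominated[OF i int]]) (auto simp: indicator_def)
  also have "\<dots> = measure (\<mu> i) A" using A by (simp add: marginals[OF i int])
  finally show ?thesis .
qed

text \<open>Compact boxes approximate the cylinder from inside and its complement from inside. All
  factors but the \<open>k\<close>-th are large compact sets \<open>K i\<close>; the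
  \<open>k\<close>-th is a compact subset \<open>C\<close> of \<open>U\<close> for the first box and
  the part of \<open>K k\<close> outside \<open>U\<close> for the second.\<close>

lemma cylinder_approximable:
  assumes k: "k \<in> I" and U: "openin (X k) U"
  shows "cylinder k U \<in> \<nu>.approximable"
  unfolding \<nu>.approximable_def
proof (intro CollectI conjI allI impI)
  fix e :: real assume e: "e > 0"
  \<comment> \<open>Mass is lost outside \<open>K i\<close> for each of the \<open>card I\<close>
    coordinates and once more in \<open>U - C\<close>, at most \<open>d\<close> each time.\<close>
  define d where "d = e / (real (card I) + 1)"
  have d: "d > 0" using e by (simp add: d_def)
  have "\<exists>K. compactin (X i) K \<and> measure (\<mu> i) (topspace (X i) - K) < d" if i: "i \<in> I" for i
    using Ulam_tight[OF polish[OF i] sets_marginal[OF i] finite_measure_marginal[OF i] d] by blast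
  then obtain K where K: "\<And>i. i \<in> I \<Longrightarrow> compactin (X i) (K i)"
    "\<And>i. i \<in> I \<Longrightarrow> measure (\<mu> i) (topspace (X i) - K i) < d" by metis
  obtain C where C: "compactin (X k) C" "C \<subseteq> U" "measure (\<mu> k) (U - C) < d"
    using inner_regular_open_polish[OF polish[OF k] sets_marginal[OF k] finite_measure_marginal[OF k] U d]
    by blast
  have closed: "closedin (X i) S" if "compactin (X i) S" "i \<in> I" for i S
    using compactin_imp_closedin[OF polish_topology_facts(2)[OF polish]] that by blast
  have sK: "topspace (X i) - K i \<in> sets (\<mu> i)" if i: "i \<in> I" for i
    using openin_borel_of[of "X i" "topspace (X i) - K i"] closed[OF K(1)[OF i] i] sets_marginal[OF i]
    by (simp add: openin_diff)
  have sC: "U - C \<in> sets (\<mu> k)"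
    using openin_borel_of[OF openin_diff[OF U closed[OF C(1) k]]] sets_marginal[OF k] by simp
  define C' where "C' = Pi\<^sub>E I (K(k := C))"
  define D' where "D' = Pi\<^sub>E I (K(k := (topspace (X k) - U) \<inter> K k))"
  have compact: "compactin T C'" "compactin T D'"
    unfolding C'_def D'_def compactin_PiE
    using K(1) C(1) k closed_Int_compactin[of "X k" "topspace (X k) - U" "K k"] U
    by (auto simp: openin_closedin_eq)
  have "topspace T - (C' \<union> D') \<subseteq>
      (\<Union>i\<in>I. cylinder i (topspace (X i) - K i)) \<union> cylinder k (U - C)" (is "?A \<subseteq> ?B \<union> ?C")
  proof
    fix x assume x: "x \<in> ?A"
    show "x \<in> ?B \<union> ?C"
    proof (rule ccontr)
      assume n: "\<not> ?thesis"
      have xK: "x i \<in> K i" if "i \<in> I" for i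
        using n x that coordinate_in_topspace by auto
      \<comment> \<open>If \<open>x k\<close> lies in \<open>U\<close> it lies in \<open>C\<close>,
        because \<open>x\<close> avoids the cylinder over \<open>U - C\<close>; otherwise it lies in
        the part of \<open>K k\<close> outside \<open>U\<close>.\<close>
      have "x k \<in> C \<or> x k \<in> (topspace (X k) - U) \<inter> K k"
        using n x k xK coordinate_in_topspace by auto
      then have "x \<in> C' \<or> x \<in> D'"
        using x xK by (auto simp: C'_def D'_def PiE_iff topspace_product_topology)
      with x show False by auto
    qed
  qed
  then have "\<nu> ?A \<le> \<nu> (?B \<union> ?C)" by (intro \<nu>.mono) auto
  also have "\<dots> \<le> \<nu> ?B + \<nu> ?C" by (intro \<nu>.subadditive) auto
  also have "\<nu> ?B \<le> (\<Sum>i\<in>I. \<nu> (cylinder i (topspace (X i) - K i)))"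
    by (intro \<nu>.subadditive_finite finite_index) auto
  also have "\<dots> \<le> (\<Sum>i\<in>I. d)"
    by (intro sum_mono, subst \<nu>_cylinder) (auto simp: sK less_imp_le[OF K(2)])
  also have "\<nu> ?C < d" using C(3) \<nu>_cylinder[OF k sC] by simp
  finally have "\<nu> ?A < real (card I) * d + d" by simp
  also have "real (card I) * d + d = (real (card I) + 1) * d" by (simp add: algebra_simps)
  also have "\<dots> = e"
  proof -
    have "real (card I) + 1 \<noteq> 0" by linarith
    then show ?thesis by (simp add: d_def)
  qed
  finally have "\<nu> ?A < e" .
  moreover have "C' \<subseteq> cylinder k U" "D' \<inter> cylinder k U = {}"
  proof -
    have "C' \<subseteq> topspace T" using compact compactin_subset_topspace by blast
    moreover have "x k \<in> C" if "x \<in> C'" for x using that k by (auto simp: C'_def dest: PiE_mem)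
    ultimately show "C' \<subseteq> cylinder k U" using C(2) by blast
    have "x k \<notin> U" if "x \<in> D'" for x using that k by (auto simp: D'_def dest: PiE_mem)
    then show "D' \<inter> cylinder k U = {}" by blast
  qed
  ultimately show "\<exists>C D. compactin T C \<and> C \<subseteq> cylinder k U \<and> compactin T D \<and> D \<inter> cylinder k U = {} \<and>
      \<nu> (topspace T - (C \<union> D)) < e"
    using compact by blast
qed auto

lemma topspace_approximable: "topspace T \<in> \<nu>.approximable"
proof -
  obtain i where i: "i \<in> I" using nonempty_index by auto
  have "cylinder i (topspace (X i)) = topspace T" using i coordinate_in_topspace by auto
  with cylinder_approximable[OF i openin_topspace] show ?thesis by simp
qed

sublocale approximable: algebra "topspace T" \<nu>.approximable
  by (rule \<nu>.algebra_approximable[OF topspace_approximable])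

text \<open>A box is a finite intersection of cylinders, and the approximable sets form an
  algebra.\<close>

lemma box_approximable:
  assumes U: "\<forall>i\<in>I. openin (X i) (U i)"
  shows "Pi\<^sub>E I U \<in> \<nu>.approximable"
proof -
  have "Pi\<^sub>E I U \<subseteq> topspace T"
    using U openin_subset by (auto simp: topspace_product_topology intro!: PiE_mono)
  moreover have "x j = undefined" if "x \<in> topspace T" "j \<notin> I" for x j
    using that by (auto simp: topspace_product_topology)
  ultimately have "Pi\<^sub>E I U = (\<Inter>i\<in>I. cylinder i (U i))"
    using nonempty_index by (auto simp: PiE_iff)
  moreover have "(\<Inter>i\<in>I. cylinder i (U i)) \<in> \<nu>.approximable"
    using U cylinder_approximable finite_index nonempty_index by (intro approximable.finite_INT) auto
  ultimately show ?thesis by simp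
qed

text \<open>A countable base of boxes writes every open set as a countable union of approximable
  sets.\<close>

lemma borel_subset_approximable: "sets (borel_of T) \<subseteq> sigma_sets (topspace T) \<nu>.approximable"
  unfolding sets_borel_of
proof (rule sigma_sets_mono, rule subsetI)
  fix U assume "U \<in> {U. openin T U}"
  then have U: "openin T U" by simp
  have "\<forall>i\<in>I. second_countable (X i)" using polish_topology_facts(3)[OF polish] by blast
  from ex_countable_box_base[OF finite_index this] obtain \<B> where \<B>: "countable \<B>"
    "\<forall>R\<in>\<B>. \<exists>A. (\<forall>i\<in>I. openin (X i) (A i)) \<and> R = Pi\<^sub>E I A"
    "\<forall>U x. openin T U \<and> x \<in> U \<longrightarrow> (\<exists>R\<in>\<B>. x \<in> R \<and> R \<subseteq> U)"
    by blast
  have "U = \<Union>{R \<in> \<B>. R \<subseteq> U}" using \<B>(3) U by blast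
  also have "\<dots> \<in> sigma_sets (topspace T) \<nu>.approximable"
  proof (rule sigma_sets_UNION)
    show "countable {R \<in> \<B>. R \<subseteq> U}" using \<B>(1) by (rule countable_subset[rotated]) auto
    fix R assume "R \<in> {R \<in> \<B>. R \<subseteq> U}"
    with \<B>(2) obtain A where "\<forall>i\<in>I. openin (X i) (A i)" "R = Pi\<^sub>E I A" by blast
    then show "R \<in> sigma_sets (topspace T) \<nu>.approximable"
      by (simp add: box_approximable sigma_sets.Basic)
  qed
  finally show "U \<in> sigma_sets (topspace T) \<nu>.approximable" .
qed

text \<open>Caratheodory's measure lives on the sigma-algebra generated by all approximable sets,
  which contains the Borel sets. Its image under the identity is its restriction to them.\<close>

lemma ex_borel_measure:
  "\<exists>\<pi>. sets \<pi> = sets (borel_of T) \<and>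
     (\<forall>A\<in>\<nu>.approximable \<inter> sets (borel_of T). emeasure \<pi> A = ennreal (\<nu> A))"
proof -
  obtain M where M: "space M = topspace T" "sets M = sigma_sets (topspace T) \<nu>.approximable"
    "\<forall>A\<in>\<nu>.approximable. emeasure M A = ennreal (\<nu> A)"
    using \<nu>.ex_measure_extension[OF topspace_approximable] by blast
  have id: "(\<lambda>x. x) \<in> measurable M (borel_of T)"
    using borel_subset_approximable M sets.sets_into_space[of _ "borel_of T"]
    by (intro measurableI) (auto simp: Int_absorb2)
  have "emeasure (distr M (borel_of T) (\<lambda>x. x)) A = ennreal (\<nu> A)"
    if A: "A \<in> \<nu>.approximable \<inter> sets (borel_of T)" for A
  proof -
    have "A \<subseteq> topspace T" using A sets.sets_into_space[of A "borel_of T"] by simp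
    then show ?thesis using A M by (subst emeasure_distr[OF id]) (auto simp: Int_absorb2)
  qed
  then show ?thesis by (intro exI[of _ "distr M (borel_of T) (\<lambda>x. x)"]) simp
qed

end

text \<open>Dominated convergence with the bound \<open>\<bar>f x\<bar>\<close> as the threshold
  grows. Unbounded dominating functions can thus be cut at a finite height at small cost.\<close>

lemma ex_small_excess:
  fixes f :: "'a \<Rightarrow> real"
  assumes f: "integrable M f" and e: "e > 0"
  shows "\<exists>b\<ge>0. (\<integral>x. max 0 (f x - b) \<partial>M) < e"
proof -
  have "(\<lambda>n. \<integral>x. max 0 (f x - real n) \<partial>M) \<longlonglongrightarrow> (\<integral>x. 0 \<partial>M)"
  proof (rule integral_dominated_convergence[where w = "\<lambda>x. \<bar>f x\<bar>"])
    show "AE x in M. (\<lambda>n. max 0 (f x - real n)) \<longlonglongrightarrow> 0"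
    proof (intro AE_I2 tendsto_eventually)
      fix x
      obtain N where "f x \<le> real N" using real_arch_simple by blast
      then show "\<forall>\<^sub>F n in sequentially. max 0 (f x - real n) = 0"
        by (intro eventually_sequentiallyI[of N]) auto
    qed
  qed (use f in auto)
  then have "\<forall>\<^sub>F n in sequentially. (\<integral>x. max 0 (f x - real n) \<partial>M) < e"
    using e by (intro order_tendstoD) auto
  then obtain n where "(\<integral>x. max 0 (f x - real n) \<partial>M) < e" by (auto simp: eventually_sequentially)
  then show ?thesis by (intro exI[of _ "real n"]) simp
qed

section \<open>Integral representation on continuous dominated functions\<close>

locale representing_measure = positive_functional I X \<mu> L
  for I :: "'i set" and X :: "'i \<Rightarrow> 'a topology" and \<mu> :: "'i \<Rightarrow> 'a measure" and L +
  fixes \<pi> :: "('i \<Rightarrow> 'a) measure"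
  assumes sets_\<pi>: "sets \<pi> = sets (borel_of T)"
    and emeasure_\<pi>: "A \<in> \<nu>.approximable \<Longrightarrow> A \<in> sets (borel_of T) \<Longrightarrow> emeasure \<pi> A = ennreal (\<nu> A)"
begin

lemma space_\<pi>: "space \<pi> = topspace T"
  using sets_eq_imp_space_eq[OF sets_\<pi>] by simp

text \<open>Open sets form an intersection-stable generator. The two measures agree on them, since
  cylinders over open sets are approximable and \<open>\<nu>\<close> has the prescribed values
  there.\<close>

lemma marginal_\<pi>:
  assumes i: "i \<in> I"
  shows "distr \<pi> (borel_of (X i)) (\<lambda>x. x i) = \<mu> i"
proof (rule measure_eqI_generator_eq[where E = "{U. openin (X i) U}" and \<Omega> = "topspace (X i)"
      and A = "\<lambda>_::nat. topspace (X i)"])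
  interpret prob_space "\<mu> i" by (rule prob_space_marginal[OF i])
  have m: "(\<lambda>x. x i) \<in> measurable \<pi> (borel_of (X i))"
    using measurable_coordinate[OF i] by (simp add: measurable_cong_sets[OF sets_\<pi> refl])
  have eq: "emeasure (distr \<pi> (borel_of (X i)) (\<lambda>x. x i)) U = emeasure (\<mu> i) U"
    if U: "openin (X i) U" for U
  proof -
    have *: "(\<lambda>x. x i) -` U \<inter> space \<pi> = cylinder i U" by (auto simp: space_\<pi>)
    have "cylinder i U \<in> sets (borel_of T)"
      using measurable_sets[OF m openin_borel_of[OF U]] * sets_\<pi> by simp
    then have "emeasure (distr \<pi> (borel_of (X i)) (\<lambda>x. x i)) U = ennreal (\<nu> (cylinder i U))"
      using emeasure_\<pi>[OF cylinder_approximable[OF i U]]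
      by (simp add: emeasure_distr[OF m openin_borel_of[OF U]] *)
    also have "\<dots> = emeasure (\<mu> i) U"
      using U openin_borel_of[OF U] sets_marginal[OF i]
      by (simp add: \<nu>_cylinder[OF i] emeasure_eq_measure)
    finally show ?thesis .
  qed
  show "Int_stable {U. openin (X i) U}" by (auto simp: Int_stable_def)
  show "{U. openin (X i) U} \<subseteq> Pow (topspace (X i))" by (auto dest: openin_subset)
  show "emeasure (distr \<pi> (borel_of (X i)) (\<lambda>x. x i)) U = emeasure (\<mu> i) U"
    if "U \<in> {U. openin (X i) U}" for U using eq that by simp
  show "emeasure (distr \<pi> (borel_of (X i)) (\<lambda>x. x i)) (topspace (X i)) \<noteq> \<infinity>"
    using eq[OF openin_topspace] by simp
qed (use i sets_marginal in \<open>auto simp: sets_borel_of\<close>)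

lemma prob_space_\<pi>: "prob_space \<pi>"
proof -
  obtain i where i: "i \<in> I" using nonempty_index by auto
  have m: "(\<lambda>x. x i) \<in> measurable \<pi> (borel_of (X i))"
    using measurable_coordinate[OF i] by (simp add: measurable_cong_sets[OF sets_\<pi> refl])
  show ?thesis
    using prob_space_distrD[OF m] prob_space_marginal[OF i] by (simp add: marginal_\<pi>[OF i])
qed

text \<open>Continuous dominated functions will be reached by sandwiching them between members of
  this space.\<close>

definition good :: "(('i \<Rightarrow> 'a) \<Rightarrow> real) set" where
  "good = {g \<in> dominated. integrable \<pi> g \<and> L g = (\<integral>x. g x \<partial>\<pi>)}"

lemma good_add: "u \<in> good \<Longrightarrow> v \<in> good \<Longrightarrow> (\<lambda>x. u x + v x) \<in> good"
  by (auto simp: good_def add_dominated L_add)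

lemma good_scale: "u \<in> good \<Longrightarrow> (\<lambda>x. a * u x) \<in> good"
  by (auto simp: good_def scale_dominated L_scale)

lemma good_coordinate: "i \<in> I \<Longrightarrow> integrable (\<mu> i) f \<Longrightarrow> (\<lambda>x. f (x i)) \<in> good"
  by (simp add: good_def coordinate_dominated marginals integral_coordinate[OF sets_\<pi> marginal_\<pi>])

lemma good_const: "(\<lambda>x. a) \<in> good"
proof -
  obtain i where i: "i \<in> I" using nonempty_index by auto
  interpret prob_space "\<mu> i" by (rule prob_space_marginal[OF i])
  show ?thesis using good_coordinate[OF i, of "\<lambda>_. a"] by simp
qed

lemma good_sum:
  assumes "finite J" "\<And>j. j \<in> J \<Longrightarrow> u j \<in> good"
  shows "(\<lambda>x. \<Sum>j\<in>J. u j x) \<in> good"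
  using assms by (induction J rule: finite_induct) (auto intro: good_const good_add)

lemma good_indicator:
  assumes A: "A \<in> \<nu>.approximable" "A \<in> sets (borel_of T)"
  shows "indicator A \<in> good"
proof -
  interpret prob_space \<pi> by (rule prob_space_\<pi>)
  have "A \<subseteq> topspace T" using A(1) by (simp add: \<nu>.approximable_def)
  then have "measure \<pi> A = \<nu> A"
    using emeasure_\<pi>[OF A] \<nu>.nonneg by (simp add: measure_def)
  moreover have "integrable \<pi> (indicator A :: ('i \<Rightarrow> 'a) \<Rightarrow> real)"
    using A(2) by (intro integrable_real_indicator) (simp_all add: sets_\<pi> less_top[symmetric])
  ultimately show ?thesis
    using A(2) by (simp add: good_def indicator_dominated sets_\<pi> \<nu>_def)
qed

text \<open>The induction assigns a constant to that part of the new set which is not yet covered,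
  so the sets in \<open>\<R>\<close> may overlap.\<close>

lemma ex_simple_approximation:
  assumes "finite \<R>" "\<R> \<subseteq> \<nu>.approximable \<inter> sets (borel_of T)"
    "\<forall>R\<in>\<R>. \<exists>a. \<forall>x\<in>R. \<bar>h x - a\<bar> \<le> e"
  shows "\<exists>s\<in>good. (\<forall>x\<in>\<Union>\<R>. \<bar>h x - s x\<bar> \<le> e) \<and> (\<forall>x. x \<notin> \<Union>\<R> \<longrightarrow> s x = 0)"
  using assms
proof (induction \<R> rule: finite_induct)
  case empty
  show ?case by (intro bexI[OF _ good_const[of 0]]) simp
next
  case (insert R \<R>)
  then obtain s where s: "s \<in> good" "\<forall>x\<in>\<Union>\<R>. \<bar>h x - s x\<bar> \<le> e" "\<forall>x. x \<notin> \<Union>\<R> \<longrightarrow> s x = 0"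
    by auto
  obtain a where a: "\<forall>x\<in>R. \<bar>h x - a\<bar> \<le> e" using insert.prems by auto
  have "R - \<Union>\<R> \<in> \<nu>.approximable" "R - \<Union>\<R> \<in> sets (borel_of T)"
    using insert by (auto intro!: approximable.Diff approximable.finite_Union sets.Diff sets.finite_Union)
  then have "(\<lambda>x. s x + a * indicator (R - \<Union>\<R>) x) \<in> good"
    by (intro good_add good_scale good_indicator s(1))
  moreover have "\<forall>x\<in>\<Union>(insert R \<R>). \<bar>h x - (s x + a * indicator (R - \<Union>\<R>) x)\<bar> \<le> e"
    using s a by (auto simp: indicator_def)
  moreover have "\<forall>x. x \<notin> \<Union>(insert R \<R>) \<longrightarrow> s x + a * indicator (R - \<Union>\<R>) x = 0"
    using s by auto
  ultimately show ?case by (intro bexI[of _ "\<lambda>x. s x + a * indicator (R - \<Union>\<R>) x"] conjI)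
qed

text \<open>By continuity each point of \<open>K\<close> has a box neighbourhood on which
  \<open>h\<close> stays within \<open>e\<close> of its value at that point; compactness selects
  finitely many boxes.\<close>

lemma ex_oscillation_cover:
  assumes h: "continuous_map T euclideanreal h" and K: "compactin T K" and e: "e > 0"
  shows "\<exists>\<R>. finite \<R> \<and> \<R> \<subseteq> \<nu>.approximable \<inter> sets (borel_of T) \<and> K \<subseteq> \<Union>\<R> \<and>
    (\<forall>R\<in>\<R>. \<exists>a. \<forall>x\<in>R. \<bar>h x - a\<bar> \<le> e)"
proof -
  define \<U> where "\<U> = {Pi\<^sub>E I U | U. (\<forall>i\<in>I. openin (X i) (U i)) \<and> (\<exists>a. \<forall>x\<in>Pi\<^sub>E I U. \<bar>h x - a\<bar> \<le> e)}"
  have open_box: "openin T R" if "R \<in> \<U>" for R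
    using that finite_index by (auto simp: \<U>_def openin_PiE_gen)
  have "K \<subseteq> \<Union>\<U>"
  proof
    fix x assume "x \<in> K"
    then have x: "x \<in> topspace T" using compactin_subset_topspace[OF K] by auto
    have "openin T {y \<in> topspace T. h y \<in> ball (h x) e}"
      by (rule openin_continuous_map_preimage[OF h]) (simp add: open_openin[symmetric])
    moreover have "x \<in> {y \<in> topspace T. h y \<in> ball (h x) e}" using x e by simp
    ultimately obtain U where U: "\<forall>i\<in>I. openin (X i) (U i)" "x \<in> Pi\<^sub>E I U"
      "Pi\<^sub>E I U \<subseteq> {y \<in> topspace T. h y \<in> ball (h x) e}"
      unfolding openin_product_topology_alt by blast
    have "\<forall>y\<in>Pi\<^sub>E I U. \<bar>h y - h x\<bar> \<le> e"
    proof
      fix y assume "y \<in> Pi\<^sub>E I U"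
      with U(3) have "h y \<in> ball (h x) e" by blast
      then show "\<bar>h y - h x\<bar> \<le> e" by (simp add: dist_real_def abs_minus_commute)
    qed
    then have "Pi\<^sub>E I U \<in> \<U>" using U(1) unfolding \<U>_def by blast
    with U(2) show "x \<in> \<Union>\<U>" by blast
  qed
  then obtain \<R> where \<R>: "finite \<R>" "\<R> \<subseteq> \<U>" "K \<subseteq> \<Union>\<R>"
    using K open_box unfolding compactin_def by meson
  have "\<R> \<subseteq> \<nu>.approximable \<inter> sets (borel_of T)"
  proof
    fix R assume "R \<in> \<R>"
    then have R: "R \<in> \<U>" using \<R>(2) by blast
    then have "R \<in> \<nu>.approximable" by (auto simp: \<U>_def box_approximable)
    with openin_borel_of[OF open_box[OF R]] show "R \<in> \<nu>.approximable \<inter> sets (borel_of T)" by simp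
  qed
  moreover have "\<forall>R\<in>\<R>. \<exists>a. \<forall>x\<in>R. \<bar>h x - a\<bar> \<le> e"
  proof
    fix R assume "R \<in> \<R>"
    then have "R \<in> \<U>" using \<R>(2) by blast
    then show "\<exists>a. \<forall>x\<in>R. \<bar>h x - a\<bar> \<le> e" unfolding \<U>_def by blast
  qed
  ultimately show ?thesis using \<R>(1,3) by blast
qed

text \<open>The error \<open>E\<close> has three parts, to each of which \<open>L\<close> assigns at
  most \<open>e / 3\<close>: the oscillation of \<open>h\<close> on the boxes, the total height
  \<open>B\<close> of the truncated bounds off the boxes, and the excess of the bounds over the
  truncation heights.\<close>

lemma ex_good_approximation:
  assumes h: "h \<in> dominated" "continuous_map T euclideanreal h" and e: "e > 0"
  shows "\<exists>s\<in>good. \<exists>E\<in>good. (\<forall>x\<in>topspace T. \<bar>h x - s x\<bar> \<le> E x) \<and> L E \<le> e"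
proof -
  obtain f where f: "\<forall>i\<in>I. integrable (\<mu> i) (f i)" "\<forall>i\<in>I. \<forall>y. 0 \<le> f i y"
    "\<forall>x\<in>topspace T. \<bar>h x\<bar> \<le> (\<Sum>i\<in>I. f i (x i))"
    using dominatedE[OF h(1)] by blast
  have card: "real (card I) > 0" using finite_index nonempty_index by (simp add: card_gt_0_iff)
  have "\<exists>b\<ge>0. (\<integral>y. max 0 (f i y - b) \<partial>\<mu> i) < e / (3 * real (card I))" if "i \<in> I" for i
    using f(1) that e card by (intro ex_small_excess) auto
  then obtain b where b: "\<And>i. i \<in> I \<Longrightarrow> 0 \<le> b i"
    "\<And>i. i \<in> I \<Longrightarrow> (\<integral>y. max 0 (f i y - b i) \<partial>\<mu> i) < e / (3 * real (card I))" by metis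
  define g where "g = (\<lambda>i y. max 0 (f i y - b i))"
  have g: "integrable (\<mu> i) (g i)" if i: "i \<in> I" for i
  proof -
    interpret prob_space "\<mu> i" by (rule prob_space_marginal[OF i])
    show ?thesis unfolding g_def using f(1) i by (intro integrable_max) auto
  qed
  define B where "B = (\<Sum>i\<in>I. b i)"
  have B: "B \<ge> 0" using b(1) by (simp add: B_def sum_nonneg)
  \<comment> \<open>Using \<open>B + 1\<close> instead of \<open>B\<close> keeps the divisor
    positive, and \<open>B * d\<close> is still at most \<open>e / 3\<close>.\<close>
  define d where "d = e / (3 * (B + 1))"
  have d: "d > 0" using e B by (simp add: d_def)
  obtain K D where KD: "compactin T K" "K \<subseteq> topspace T" "compactin T D" "D \<inter> topspace T = {}"
    "\<nu> (topspace T - (K \<union> D)) < d"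
    using \<nu>.approximableD[OF topspace_approximable d] by blast
  have "D = {}" using KD(3,4) compactin_subset_topspace by blast
  with KD(5) have Kd: "\<nu> (topspace T - K) < d" by simp
  have e3: "e / 3 > 0" using e by simp
  obtain \<R> where \<R>: "finite \<R>" "\<R> \<subseteq> \<nu>.approximable \<inter> sets (borel_of T)" "K \<subseteq> \<Union>\<R>"
    "\<forall>R\<in>\<R>. \<exists>a. \<forall>x\<in>R. \<bar>h x - a\<bar> \<le> e / 3"
    using ex_oscillation_cover[OF h(2) KD(1) e3] by blast
  obtain s where s: "s \<in> good" "\<forall>x\<in>\<Union>\<R>. \<bar>h x - s x\<bar> \<le> e / 3" "\<forall>x. x \<notin> \<Union>\<R> \<longrightarrow> s x = 0"
    using ex_simple_approximation[OF \<R>(1,2,4)] by blast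
  have R': "topspace T - \<Union>\<R> \<in> \<nu>.approximable" "topspace T - \<Union>\<R> \<in> sets (borel_of T)"
    using \<R>(1,2) openin_borel_of[OF openin_topspace]
    by (auto intro!: approximable.Diff approximable.finite_Union sets.Diff sets.finite_Union)
  define E where "E = (\<lambda>x. (e / 3 + B * indicator (topspace T - \<Union>\<R>) x) + (\<Sum>i\<in>I. g i (x i)))"
  have good: "(\<lambda>x. e / 3 + B * indicator (topspace T - \<Union>\<R>) x) \<in> good" "(\<lambda>x. \<Sum>i\<in>I. g i (x i)) \<in> good"
    using g R' by (auto intro!: good_add good_const good_scale good_indicator good_sum good_coordinate finite_index)
  have "E \<in> good" unfolding E_def by (rule good_add[OF good])
  moreover have "\<bar>h x - s x\<bar> \<le> E x" if x: "x \<in> topspace T" for x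
  proof (cases "x \<in> \<Union>\<R>")
    case True
    then have "\<bar>h x - s x\<bar> \<le> e / 3" using s(2) by blast
    also have "\<dots> \<le> E x" using B by (simp add: E_def g_def sum_nonneg)
    finally show ?thesis .
  next
    case False
    \<comment> \<open>Off the boxes \<open>s\<close> vanishes, so the error is
      \<open>\<bar>h x\<bar>\<close>, which the dominating sum controls.\<close>
    then have "\<bar>h x - s x\<bar> \<le> (\<Sum>i\<in>I. f i (x i))" using s(3) f(3) x by simp
    also have "\<dots> \<le> (\<Sum>i\<in>I. b i + g i (x i))" by (intro sum_mono) (auto simp: g_def)
    also have "\<dots> \<le> E x" using False x e by (simp add: E_def B_def sum.distrib)
    finally show ?thesis .
  qed
  moreover have "L E \<le> e"
  proof -
    have prob: "L (\<lambda>x. a) = a" for a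
    proof -
      interpret prob_space \<pi> by (rule prob_space_\<pi>)
      show ?thesis using good_const[of a] by (simp add: good_def prob_space)
    qed
    have "L E = L (\<lambda>x. e / 3 + B * indicator (topspace T - \<Union>\<R>) x) + L (\<lambda>x. \<Sum>i\<in>I. g i (x i))"
      unfolding E_def by (rule L_add) (use good in \<open>auto simp: good_def\<close>)
    also have "L (\<lambda>x. e / 3 + B * indicator (topspace T - \<Union>\<R>) x) = e / 3 + B * \<nu> (topspace T - \<Union>\<R>)"
      by (subst L_add, intro const_dominated, intro scale_dominated indicator_dominated)
         (simp add: L_scale indicator_dominated \<nu>_def prob)
    also have "L (\<lambda>x. \<Sum>i\<in>I. g i (x i)) = (\<Sum>i\<in>I. \<integral>y. g i y \<partial>\<mu> i)"
    proof -
      have "L (\<lambda>x. \<Sum>i\<in>I. g i (x i)) = (\<integral>x. (\<Sum>i\<in>I. g i (x i)) \<partial>\<pi>)" using good(2) by (simp add: good_def)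
      also have "\<dots> = (\<Sum>i\<in>I. \<integral>x. g i (x i) \<partial>\<pi>)"
        using g by (intro Bochner_Integration.integral_sum integral_coordinate(1)[OF sets_\<pi> marginal_\<pi>])
      also have "\<dots> = (\<Sum>i\<in>I. \<integral>y. g i y \<partial>\<mu> i)"
        using g by (intro sum.cong refl integral_coordinate(2)[OF sets_\<pi> marginal_\<pi>])
      finally show ?thesis .
    qed
    also have "(\<Sum>i\<in>I. \<integral>y. g i y \<partial>\<mu> i) \<le> (\<Sum>i\<in>I. e / (3 * real (card I)))"
      using b(2) unfolding g_def by (intro sum_mono less_imp_le)
    also have "\<dots> = e / 3" using card by simp
    also have "B * \<nu> (topspace T - \<Union>\<R>) \<le> e / 3"
    proof -
      have "\<nu> (topspace T - \<Union>\<R>) \<le> \<nu> (topspace T - K)" using \<R>(3) by (intro \<nu>.mono) auto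
      then have "B * \<nu> (topspace T - \<Union>\<R>) \<le> B * d" using Kd B by (intro mult_left_mono) auto
      also have "\<dots> \<le> (B + 1) * d" using d by simp
      also have "\<dots> = e / 3"
      proof -
        have "B + 1 \<noteq> 0" using B by linarith
        then show ?thesis by (simp add: d_def divide_simps)
      qed
      finally show ?thesis .
    qed
    finally show ?thesis by simp
  qed
  ultimately show ?thesis using s(1) by blast
qed

text \<open>Both \<open>L\<close> and the integral are monotone and they agree on \<open>s\<close>
  and \<open>E\<close>. Each of them changes by at most \<open>L E\<close> between \<open>s\<close>
  and \<open>h\<close>, and \<open>L E\<close> is arbitrarily small.\<close>

lemma L_eq_integral:
  assumes h: "h \<in> dominated" "continuous_map T euclideanreal h"
  shows "L h = (\<integral>x. h x \<partial>\<pi>)"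
proof -
  have int: "integrable \<pi> h"
    using integrable_dominated[OF sets_\<pi> marginal_\<pi> h(1) continuous_map_borel_measurable[OF h(2)]] by simp
  have "\<bar>L h - (\<integral>x. h x \<partial>\<pi>)\<bar> \<le> e" if e: "e > 0" for e
  proof -
    have "e / 2 > 0" using e by simp
    then obtain s E where sE: "s \<in> good" "E \<in> good" "\<And>x. x \<in> topspace T \<Longrightarrow> \<bar>h x - s x\<bar> \<le> E x" "L E \<le> e / 2"
      using ex_good_approximation[OF h] by blast
    have gs: "s \<in> dominated" "integrable \<pi> s" "L s = (\<integral>x. s x \<partial>\<pi>)"
      and gE: "E \<in> dominated" "integrable \<pi> E" "L E = (\<integral>x. E x \<partial>\<pi>)"
      using sE(1,2) by (auto simp: good_def)
    have "L (\<lambda>x. h x - s x) \<le> L E"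
      using sE(3) by (intro L_mono diff_dominated h gs gE) (auto simp: abs_le_iff)
    moreover have "L (\<lambda>x. s x - h x) \<le> L E"
      using sE(3) by (intro L_mono diff_dominated h gs gE) (auto simp: abs_le_iff)
    moreover have "(\<integral>x. h x - s x \<partial>\<pi>) \<le> (\<integral>x. E x \<partial>\<pi>)"
      by (rule integral_mono) (use sE(3) int gs(2) gE(2) in \<open>auto simp: space_\<pi> abs_le_iff\<close>)
    moreover have "(\<integral>x. s x - h x \<partial>\<pi>) \<le> (\<integral>x. E x \<partial>\<pi>)"
      by (rule integral_mono) (use sE(3) int gs(2) gE(2) in \<open>auto simp: space_\<pi> abs_le_iff\<close>)
    ultimately show ?thesis
      using sE(4) int gs gE h(1) by (auto simp: L_diff)
  qed
  then show ?thesis using field_le_epsilon[of "\<bar>L h - (\<integral>x. h x \<partial>\<pi>)\<bar>" 0] by simp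
qed

end

theorem (in positive_functional) ex_representing_measure:
  "\<exists>\<pi>. sets \<pi> = sets (borel_of T) \<and> prob_space \<pi> \<and>
     (\<forall>i\<in>I. distr \<pi> (borel_of (X i)) (\<lambda>x. x i) = \<mu> i) \<and>
     (\<forall>h\<in>dominated. continuous_map T euclideanreal h \<longrightarrow> L h = (\<integral>x. h x \<partial>\<pi>))"
proof -
  obtain \<pi> where \<pi>: "sets \<pi> = sets (borel_of T)"
    "\<forall>A\<in>\<nu>.approximable \<inter> sets (borel_of T). emeasure \<pi> A = ennreal (\<nu> A)"
    using ex_borel_measure by blast
  interpret representing_measure I X \<mu> L \<pi>
    by unfold_locales (use \<pi> in auto)
  show ?thesis
    using \<pi>(1) prob_space_\<pi> marginal_\<pi> L_eq_integral by blast
qed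

section \<open>Duality\<close>

text \<open>Every point outside the support lies in a null set of a countable base, so these points
  are covered by countably many null sets.\<close>

lemma AE_in_supp:
  assumes T: "second_countable T" and M: "sets M = sets (borel_of T)"
  shows "AE x in M. x \<in> supp T M"
proof -
  obtain \<B> where \<B>: "countable \<B>" "\<forall>V\<in>\<B>. openin T V"
    "\<forall>U x. openin T U \<and> x \<in> U \<longrightarrow> (\<exists>V\<in>\<B>. x \<in> V \<and> V \<subseteq> U)"
    using T by (auto simp: second_countable_def)
  define \<N> where "\<N> = {V \<in> \<B>. emeasure M V = 0}"
  have "countable \<N>" using \<B>(1) by (rule countable_subset[rotated]) (auto simp: \<N>_def)
  moreover have "V \<in> null_sets M" if "V \<in> \<N>" for V
    using that \<B>(2) openin_borel_of[of T V] M by (auto simp: \<N>_def null_sets_def)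
  ultimately have null: "(\<Union>V\<in>\<N>. V) \<in> null_sets M" by (rule null_sets_UN')
  have space: "space M = topspace T" using sets_eq_imp_space_eq[OF M] by simp
  have "{x \<in> space M. x \<notin> supp T M} \<subseteq> (\<Union>V\<in>\<N>. V)"
  proof
    fix x assume "x \<in> {x \<in> space M. x \<notin> supp T M}"
    then obtain U where U: "openin T U" "x \<in> U" "emeasure M U = 0"
      by (auto simp: supp_def space)
    with \<B>(3) obtain V where V: "V \<in> \<B>" "x \<in> V" "V \<subseteq> U" by blast
    have "emeasure M V \<le> emeasure M U"
      using V(3) U(1) openin_borel_of M by (intro emeasure_mono) auto
    with V U(3) show "x \<in> (\<Union>V\<in>\<N>. V)" by (auto simp: \<N>_def)
  qed
  with null show ?thesis by (rule AE_I')
qed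

text \<open>The estimate involves only the values on \<open>S\<close> and the total mass, so it
  tends to 0 along functions that tend to 0 at each point of \<open>S\<close>.\<close>

lemma (in finite_measure) integrable_AE_finite:
  fixes f :: "'a \<Rightarrow> real"
  assumes S: "finite S" "AE x in M. x \<in> S" and f: "f \<in> borel_measurable M"
  shows "integrable M f" "\<bar>\<integral>x. f x \<partial>M\<bar> \<le> (\<Sum>s\<in>S. \<bar>f s\<bar>) * measure M (space M)"
proof -
  have b: "AE x in M. norm (f x) \<le> (\<Sum>s\<in>S. \<bar>f s\<bar>)"
    using S(2)
  proof eventually_elim
    case (elim x)
    then show ?case using member_le_sum[of x S "\<lambda>s. \<bar>f s\<bar>"] S(1) by simp
  qed
  show int: "integrable M f" by (rule integrable_const_bound[OF b f])
  have "\<bar>\<integral>x. f x \<partial>M\<bar> \<le> (\<integral>x. \<bar>f x\<bar> \<partial>M)" by (rule integral_abs_bound)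
  also have "\<dots> \<le> (\<integral>x. (\<Sum>s\<in>S. \<bar>f s\<bar>) \<partial>M)"
    using b int by (intro integral_mono_AE) auto
  finally show "\<bar>\<integral>x. f x \<partial>M\<bar> \<le> (\<Sum>s\<in>S. \<bar>f s\<bar>) * measure M (space M)"
    by (simp add: mult.commute)
qed

section \<open>The dual value as a sublinear functional\<close>

locale constrained_plan = polish_marginals I X \<mu>
  for I :: "'i set" and X :: "'i \<Rightarrow> 'a topology" and \<mu> :: "'i \<Rightarrow> 'a measure" +
  fixes W :: "(('i \<Rightarrow> 'a) \<Rightarrow> real) set" and \<pi>0 :: "('i \<Rightarrow> 'a) measure"
  assumes W_dominated: "w \<in> W \<Longrightarrow> w \<in> dominated"
    and W_continuous: "w \<in> W \<Longrightarrow> continuous_map T euclideanreal w"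
    and W_subspace: "function_subspace (topspace T) W"
    and sets_plan: "sets \<pi>0 = sets (borel_of T)"
    and marginal_plan: "i \<in> I \<Longrightarrow> distr \<pi>0 (borel_of (X i)) (\<lambda>x. x i) = \<mu> i"
    and plan_W: "w \<in> W \<Longrightarrow> (\<integral>x. w x \<partial>\<pi>0) = 0"
begin

lemma space_plan: "space \<pi>0 = topspace T"
  using sets_eq_imp_space_eq[OF sets_plan] by simp

lemma W_measurable: "w \<in> W \<Longrightarrow> w \<in> borel_measurable (borel_of T)"
  by (rule continuous_map_borel_measurable[OF W_continuous])

lemma W_integrable: "w \<in> W \<Longrightarrow> integrable \<pi>0 w"
  by (rule integrable_dominated[OF sets_plan marginal_plan W_dominated W_measurable])

lemma W_zero: "(\<lambda>x\<in>topspace T. 0) \<in> W"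
  and W_add: "u \<in> W \<Longrightarrow> v \<in> W \<Longrightarrow> (\<lambda>x\<in>topspace T. u x + v x) \<in> W"
  and W_scale: "u \<in> W \<Longrightarrow> (\<lambda>x\<in>topspace T. a * u x) \<in> W"
  using W_subspace by (auto simp: function_subspace_def)

text \<open>The dual problem is taken for upper bounds of \<open>h = - c\<close>, which makes its value sublinear in \<open>h\<close>.\<close>

definition dual_bound :: "('i \<Rightarrow> 'a \<Rightarrow> real) \<Rightarrow> (('i \<Rightarrow> 'a) \<Rightarrow> real) \<Rightarrow> (('i \<Rightarrow> 'a) \<Rightarrow> real) \<Rightarrow> bool" where
  "dual_bound f w h \<longleftrightarrow> (\<forall>i\<in>I. integrable (\<mu> i) (f i)) \<and> w \<in> W \<and>
     (\<forall>x\<in>topspace T. h x \<le> (\<Sum>i\<in>I. f i (x i)) + w x)"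

definition dual_values :: "(('i \<Rightarrow> 'a) \<Rightarrow> real) \<Rightarrow> real set" where
  "dual_values h = {\<Sum>i\<in>I. \<integral>y. f i y \<partial>\<mu> i | f w. dual_bound f w h}"

definition dual :: "(('i \<Rightarrow> 'a) \<Rightarrow> real) \<Rightarrow> real" where
  "dual h = Inf (dual_values h)"

lemma dual_valuesI: "dual_bound f w h \<Longrightarrow> (\<Sum>i\<in>I. \<integral>y. f i y \<partial>\<mu> i) \<in> dual_values h"
  by (auto simp: dual_values_def)

lemma dual_values_nonempty:
  assumes "h \<in> dominated"
  shows "dual_values h \<noteq> {}"
proof -
  obtain f where f: "\<forall>i\<in>I. integrable (\<mu> i) (f i)" "\<forall>i\<in>I. \<forall>y. 0 \<le> f i y"
    "\<forall>x\<in>topspace T. \<bar>h x\<bar> \<le> (\<Sum>i\<in>I. f i (x i))"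
    using dominatedE[OF assms] by blast
  then have "dual_bound f (\<lambda>x\<in>topspace T. 0) h"
    by (auto simp: dual_bound_def W_zero abs_le_iff)
  then show ?thesis using dual_valuesI by blast
qed

text \<open>The plan has the marginals \<open>\<mu>\<close> and annihilates \<open>W\<close>, so
  integrating a dual bound against it returns the dual value of that bound.\<close>

lemma plan_integral_dual_bound:
  assumes "dual_bound f w h"
  shows "integrable \<pi>0 (\<lambda>x. (\<Sum>i\<in>I. f i (x i)) + w x)"
    "(\<integral>x. (\<Sum>i\<in>I. f i (x i)) + w x \<partial>\<pi>0) = (\<Sum>i\<in>I. \<integral>y. f i y \<partial>\<mu> i)"
proof -
  have f: "integrable (\<mu> i) (f i)" if "i \<in> I" for i using assms that by (simp add: dual_bound_def)
  have w: "w \<in> W" using assms by (simp add: dual_bound_def)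
  have int: "integrable \<pi>0 (\<lambda>x. f i (x i))" if "i \<in> I" for i
    by (rule integral_coordinate(1)[OF sets_plan marginal_plan[OF that] that f[OF that]])
  show "integrable \<pi>0 (\<lambda>x. (\<Sum>i\<in>I. f i (x i)) + w x)"
    using int W_integrable[OF w] by (intro Bochner_Integration.integrable_add Bochner_Integration.integrable_sum)
  have "(\<integral>x. (\<Sum>i\<in>I. f i (x i)) + w x \<partial>\<pi>0) = (\<Sum>i\<in>I. \<integral>x. f i (x i) \<partial>\<pi>0)"
    using int W_integrable[OF w] by (simp add: Bochner_Integration.integral_sum plan_W[OF w])
  also have "\<dots> = (\<Sum>i\<in>I. \<integral>y. f i y \<partial>\<mu> i)"
    using f by (intro sum.cong refl integral_coordinate(2)[OF sets_plan marginal_plan])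
  finally show "(\<integral>x. (\<Sum>i\<in>I. f i (x i)) + w x \<partial>\<pi>0) = (\<Sum>i\<in>I. \<integral>y. f i y \<partial>\<mu> i)" .
qed

text \<open>Weak duality: every dual bound lies above \<open>h\<close>, hence above the negative of
  a dominating sum, whose integral against \<open>\<pi>0\<close> does not depend on the dual
  bound.\<close>

lemma bdd_below_dual_values:
  assumes "h \<in> dominated"
  shows "bdd_below (dual_values h)"
proof -
  obtain g where g: "\<forall>i\<in>I. integrable (\<mu> i) (g i)" "\<forall>i\<in>I. \<forall>y. 0 \<le> g i y"
    "\<forall>x\<in>topspace T. \<bar>h x\<bar> \<le> (\<Sum>i\<in>I. g i (x i))"
    using dominatedE[OF assms] by blast
  have int: "integrable \<pi>0 (\<lambda>x. - (\<Sum>i\<in>I. g i (x i)))"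
    using g(1) by (intro Bochner_Integration.integrable_minus Bochner_Integration.integrable_sum
        integral_coordinate(1)[OF sets_plan marginal_plan]) auto
  have "(\<integral>x. - (\<Sum>i\<in>I. g i (x i)) \<partial>\<pi>0) \<le> r" if r_mem: "r \<in> dual_values h" for r
  proof -
    obtain f w where fw: "dual_bound f w h" and r: "r = (\<Sum>i\<in>I. \<integral>y. f i y \<partial>\<mu> i)"
      using r_mem unfolding dual_values_def by blast
    have "(\<integral>x. - (\<Sum>i\<in>I. g i (x i)) \<partial>\<pi>0) \<le> (\<integral>x. (\<Sum>i\<in>I. f i (x i)) + w x \<partial>\<pi>0)"
    proof (rule integral_mono[OF int plan_integral_dual_bound(1)[OF fw]])
      fix x assume "x \<in> space \<pi>0"
      then have x: "x \<in> topspace T" by (simp add: space_plan)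
      have "- (\<Sum>i\<in>I. g i (x i)) \<le> h x" using g(3) x by (auto simp: abs_le_iff)
      also have "h x \<le> (\<Sum>i\<in>I. f i (x i)) + w x" using fw x by (simp add: dual_bound_def)
      finally show "- (\<Sum>i\<in>I. g i (x i)) \<le> (\<Sum>i\<in>I. f i (x i)) + w x" .
    qed
    then show ?thesis by (simp add: plan_integral_dual_bound(2)[OF fw] r)
  qed
  then show ?thesis by (auto simp: bdd_below_def)
qed

lemma dual_le:
  assumes "h \<in> dominated" "dual_bound f w h"
  shows "dual h \<le> (\<Sum>i\<in>I. \<integral>y. f i y \<partial>\<mu> i)"
  unfolding dual_def by (rule cInf_lower[OF dual_valuesI[OF assms(2)] bdd_below_dual_values[OF assms(1)]])

lemma le_dual:
  assumes "h \<in> dominated" "\<And>f w. dual_bound f w h \<Longrightarrow> b \<le> (\<Sum>i\<in>I. \<integral>y. f i y \<partial>\<mu> i)"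
  shows "b \<le> dual h"
  unfolding dual_def
  by (rule cInf_greatest[OF dual_values_nonempty[OF assms(1)]]) (use assms(2) in \<open>auto simp: dual_values_def\<close>)

lemma dual_bound_W: "w \<in> W \<Longrightarrow> (\<And>x. x \<in> topspace T \<Longrightarrow> h x \<le> w x) \<Longrightarrow> dual_bound (\<lambda>i y. 0) w h"
  by (simp add: dual_bound_def)

text \<open>Upper bounds taken from \<open>W\<close> cost nothing. This will make the Hahn-Banach
  functional positive and zero on \<open>W\<close>.\<close>

lemma dual_le_0: "h \<in> dominated \<Longrightarrow> w \<in> W \<Longrightarrow> (\<And>x. x \<in> topspace T \<Longrightarrow> h x \<le> w x) \<Longrightarrow> dual h \<le> 0"
  using dual_le[OF _ dual_bound_W] by fastforce

lemma dual_nonneg: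
  assumes "h \<in> dominated" "\<And>x. x \<in> topspace T \<Longrightarrow> 0 \<le> h x"
  shows "0 \<le> dual h"
proof (rule le_dual[OF assms(1)])
  fix f w assume fw: "dual_bound f w h"
  have "0 \<le> (\<integral>x. (\<Sum>i\<in>I. f i (x i)) + w x \<partial>\<pi>0)"
  proof (rule Bochner_Integration.integral_nonneg)
    fix x assume "x \<in> space \<pi>0"
    then have x: "x \<in> topspace T" by (simp add: space_plan)
    have "h x \<le> (\<Sum>i\<in>I. f i (x i)) + w x" using fw x by (simp add: dual_bound_def)
    with assms(2)[OF x] show "0 \<le> (\<Sum>i\<in>I. f i (x i)) + w x" by linarith
  qed
  then show "0 \<le> (\<Sum>i\<in>I. \<integral>y. f i y \<partial>\<mu> i)" by (simp add: plan_integral_dual_bound(2)[OF fw])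
qed

text \<open>Dual bounds can be added and scaled by positive factors because \<open>W\<close> is a
  subspace, and their values are linear in the bound. Homogeneity again follows from one inequality
  applied to a factor and to its inverse.\<close>

lemma sublinear_dual: "sublinear_on dominated dual"
  unfolding sublinear_on_def
proof (intro conjI ballI allI impI)
  fix u v assume u: "u \<in> dominated" and v: "v \<in> dominated"
  have *: "dual (\<lambda>x. u x + v x) \<le> (\<Sum>i\<in>I. \<integral>y. f i y \<partial>\<mu> i) + (\<Sum>i\<in>I. \<integral>y. g i y \<partial>\<mu> i)"
    if f: "dual_bound f w u" and g: "dual_bound g w' v" for f w g w'
  proof -
    have "dual_bound (\<lambda>i y. f i y + g i y) (\<lambda>x\<in>topspace T. w x + w' x) (\<lambda>x. u x + v x)"
      using f g W_add by (fastforce simp: dual_bound_def sum.distrib intro: add_mono)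
    from dual_le[OF add_dominated[OF u v] this]
    have "dual (\<lambda>x. u x + v x) \<le> (\<Sum>i\<in>I. \<integral>y. f i y + g i y \<partial>\<mu> i)" .
    also have "\<dots> = (\<Sum>i\<in>I. (\<integral>y. f i y \<partial>\<mu> i) + (\<integral>y. g i y \<partial>\<mu> i))"
      using f g by (intro sum.cong refl Bochner_Integration.integral_add) (auto simp: dual_bound_def)
    finally show ?thesis by (simp add: sum.distrib)
  qed
  have "dual (\<lambda>x. u x + v x) - (\<Sum>i\<in>I. \<integral>y. g i y \<partial>\<mu> i) \<le> dual u" if "dual_bound g w' v" for g w'
    by (rule le_dual[OF u]) (use *[OF _ that] in \<open>simp add: algebra_simps\<close>)
  then have "dual (\<lambda>x. u x + v x) - dual u \<le> dual v"
    by (intro le_dual[OF v]) (simp add: algebra_simps)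
  then show "dual (\<lambda>x. u x + v x) \<le> dual u + dual v" by simp
next
  fix a :: real and u assume a: "a \<ge> 0" and u: "u \<in> dominated"
  have le: "b * dual v \<le> dual (\<lambda>x. b * v x)" if b: "b > 0" and v: "v \<in> dominated" for b v
  proof (rule le_dual[OF scale_dominated[OF v]])
    fix f w assume fw: "dual_bound f w (\<lambda>x. b * v x)"
    have "dual_bound (\<lambda>i y. (1 / b) * f i y) (\<lambda>x\<in>topspace T. (1 / b) * w x) v"
      unfolding dual_bound_def
    proof (intro conjI ballI)
      show "(\<lambda>x\<in>topspace T. (1 / b) * w x) \<in> W" using fw by (intro W_scale) (simp add: dual_bound_def)
      show "integrable (\<mu> i) (\<lambda>y. (1 / b) * f i y)" if "i \<in> I" for i
        using fw that by (simp add: dual_bound_def)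
      fix x assume x: "x \<in> topspace T"
      then have "b * v x \<le> (\<Sum>i\<in>I. f i (x i)) + w x" using fw by (simp add: dual_bound_def)
      then have "v x \<le> ((\<Sum>i\<in>I. f i (x i)) + w x) / b" using b by (simp add: field_simps)
      also have "\<dots> = (\<Sum>i\<in>I. (1 / b) * f i (x i)) + (\<lambda>x\<in>topspace T. (1 / b) * w x) x"
        using x by (simp add: add_divide_distrib sum_divide_distrib)
      finally show "v x \<le> (\<Sum>i\<in>I. (1 / b) * f i (x i)) + (\<lambda>x\<in>topspace T. (1 / b) * w x) x" .
    qed
    from dual_le[OF v this] have "dual v \<le> (\<Sum>i\<in>I. (1 / b) * (\<integral>y. f i y \<partial>\<mu> i))" by simp
    also have "\<dots> = (1 / b) * (\<Sum>i\<in>I. \<integral>y. f i y \<partial>\<mu> i)" by (simp only: sum_distrib_left)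
    finally show "b * dual v \<le> (\<Sum>i\<in>I. \<integral>y. f i y \<partial>\<mu> i)" using b by (simp add: field_simps)
  qed
  show "dual (\<lambda>x. a * u x) = a * dual u"
  proof (cases "a = 0")
    case True
    have "dual (\<lambda>x. 0) \<le> 0" by (rule dual_le_0[OF const_dominated W_zero]) simp
    \<comment> \<open>The existence of the plan enters here: it keeps the dual value of 0 from
      falling below 0.\<close>
    moreover have "0 \<le> dual (\<lambda>x. 0)" by (rule dual_nonneg[OF const_dominated]) simp
    ultimately show ?thesis using True by simp
  next
    case False
    with a have a: "a > 0" by simp
    have "(1 / a) * dual (\<lambda>x. a * u x) \<le> dual (\<lambda>x. (1 / a) * (a * u x))"
      using a by (intro le scale_dominated u) simp
    then have "dual (\<lambda>x. a * u x) \<le> a * dual u" using a by (simp add: field_simps)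
    with le[OF a u] show ?thesis by simp
  qed
qed

text \<open>A Hahn-Banach extension attaining \<open>dual h\<close> is represented by a competitor of the optimal plan.\<close>

lemma dual_le_plan_integral:
  assumes h: "h \<in> dominated" "continuous_map T euclideanreal h"
    and optimal: "\<And>\<pi>. sets \<pi> = sets (borel_of T) \<Longrightarrow> prob_space \<pi> \<Longrightarrow>
      \<forall>i\<in>I. distr \<pi> (borel_of (X i)) (\<lambda>x. x i) = \<mu> i \<Longrightarrow> \<forall>w\<in>W. (\<integral>x. w x \<partial>\<pi>) = 0 \<Longrightarrow>
      (\<integral>x. h x \<partial>\<pi>) \<le> (\<integral>x. h x \<partial>\<pi>0)"
  shows "dual h \<le> (\<integral>x. h x \<partial>\<pi>0)"
proof -
  interpret d: sublinear_functional dominated dual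
    by unfold_locales (fact function_subspace_dominated sublinear_dual)+
  obtain L where L: "linear_functional_on dominated L" "\<And>u. u \<in> dominated \<Longrightarrow> L u \<le> dual u" "L h = dual h"
    using d.hahn_banach[OF h(1)] by blast
  have scale: "L (\<lambda>x. a * u x) = a * L u" if "u \<in> dominated" for a u
    using L(1) that by (simp add: linear_functional_on_def)
  have uminus: "L (\<lambda>x. - u x) = - L u" if "u \<in> dominated" for u
    using scale[OF that, of "-1"] by simp
  \<comment> \<open>The function \<open>f\<close> in coordinate \<open>i\<close> together with 0 in
    the others is a dual bound whose value is the marginal integral. Applied to the negative of
    \<open>f\<close> as well, the estimate will give equality.\<close>
  have coordinate_le: "L (\<lambda>x. f (x i)) \<le> (\<integral>y. f y \<partial>\<mu> i)" if i: "i \<in> I" and f: "integrable (\<mu> i) f" for i f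
  proof -
    define g where "g = (\<lambda>j y. if j = i then f y else 0)"
    have "dual_bound g (\<lambda>x\<in>topspace T. 0) (\<lambda>x. f (x i))"
      unfolding dual_bound_def
    proof (intro conjI ballI W_zero)
      show "integrable (\<mu> j) (g j)" for j using f by (cases "j = i") (auto simp: g_def)
      fix x assume "x \<in> topspace T"
      then show "f (x i) \<le> (\<Sum>j\<in>I. g j (x j)) + (\<lambda>x\<in>topspace T. 0) x"
        using i finite_index by (simp add: g_def)
    qed
    from dual_le[OF coordinate_dominated[OF i f] this]
    have "dual (\<lambda>x. f (x i)) \<le> (\<Sum>j\<in>I. \<integral>y. g j y \<partial>\<mu> j)" .
    also have "\<dots> = (\<Sum>j\<in>I. if j = i then \<integral>y. f y \<partial>\<mu> i else 0)"
      by (intro sum.cong refl) (simp add: g_def)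
    also have "\<dots> = (\<integral>y. f y \<partial>\<mu> i)" using i finite_index by simp
    finally show ?thesis using L(2)[OF coordinate_dominated[OF i f]] by simp
  qed
  interpret positive_functional I X \<mu> L
  proof unfold_locales
    show "linear_functional_on dominated L" by (rule L(1))
  next
    fix u assume u: "u \<in> dominated" "\<And>x. x \<in> topspace T \<Longrightarrow> 0 \<le> u x"
    have u': "(\<lambda>x. - u x) \<in> dominated" using scale_dominated[OF u(1), of "-1"] by simp
    have "L (\<lambda>x. - u x) \<le> dual (\<lambda>x. - u x)" by (rule L(2)[OF u'])
    also have "\<dots> \<le> 0" by (rule dual_le_0[OF u' W_zero]) (use u(2) in simp)
    finally show "0 \<le> L u" by (simp add: uminus[OF u(1)])
  next
    fix i and f :: "'a \<Rightarrow> real" assume i: "i \<in> I" and f: "integrable (\<mu> i) f"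
    have "L (\<lambda>x. - f (x i)) \<le> - (\<integral>y. f y \<partial>\<mu> i)"
      using coordinate_le[OF i, of "\<lambda>y. - f y"] f by simp
    then show "L (\<lambda>x. f (x i)) = (\<integral>y. f y \<partial>\<mu> i)"
      using coordinate_le[OF i f] by (simp add: uminus[OF coordinate_dominated[OF i f]])
  qed
  obtain \<pi> where \<pi>: "sets \<pi> = sets (borel_of T)" "prob_space \<pi>"
    "\<forall>i\<in>I. distr \<pi> (borel_of (X i)) (\<lambda>x. x i) = \<mu> i"
    "\<forall>h\<in>dominated. continuous_map T euclideanreal h \<longrightarrow> L h = (\<integral>x. h x \<partial>\<pi>)"
    using ex_representing_measure by blast
  have "\<forall>w\<in>W. (\<integral>x. w x \<partial>\<pi>) = 0"
  proof
    fix w assume w: "w \<in> W"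
    note wd = W_dominated[OF w]
    have w': "(\<lambda>x. - w x) \<in> dominated" using scale_dominated[OF wd, of "-1"] by simp
    \<comment> \<open>On the product both \<open>w\<close> and its negative agree with members of
      \<open>W\<close>, so \<open>L\<close> is nonpositive at both.\<close>
    have "L w \<le> 0" using L(2)[OF wd] dual_le_0[OF wd w] by simp
    moreover have "dual (\<lambda>x. - w x) \<le> 0"
      by (rule dual_le_0[OF w' W_scale[OF w, of "-1"]]) simp
    then have "L (\<lambda>x. - w x) \<le> 0" using L(2)[OF w'] by simp
    ultimately have "L w = 0" by (simp add: uminus[OF wd])
    then show "(\<integral>x. w x \<partial>\<pi>) = 0" using \<pi>(4) wd W_continuous[OF w] by simp
  qed
  \<comment> \<open>The representing measure is an admissible competitor, and its integral of
    \<open>h\<close> is \<open>L h = dual h\<close>.\<close>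
  from optimal[OF \<pi>(1-3) this] show ?thesis
    using \<pi>(4) h L(3) by simp
qed

text \<open>Integrating the nonnegative function \<open>c + \<Sum>i. f i (x i) + w\<close> against measures that
  agree on all \<open>f i\<close> and on \<open>w\<close> only sees \<open>c\<close>.\<close>

lemma integral_diff_le:
  assumes fw: "dual_bound f w (\<lambda>x. - c x)" and c: "continuous_map T euclideanreal c"
    and \<alpha>: "sets \<alpha> = sets (borel_of T)" "finite_measure \<alpha>" "finite A" "AE x in \<alpha>. x \<in> A"
    and \<beta>: "sets \<beta> = sets (borel_of T)" "finite_measure \<beta>" "finite B" "AE x in \<beta>. x \<in> B"
    and marginal: "\<forall>i\<in>I. distr \<alpha> (borel_of (X i)) (\<lambda>x. x i) = distr \<beta> (borel_of (X i)) (\<lambda>x. x i)"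
    and W: "\<forall>w\<in>W. (\<integral>x. w x \<partial>\<alpha>) = (\<integral>x. w x \<partial>\<beta>)"
  shows "(\<integral>x. c x \<partial>\<beta>) - (\<integral>x. c x \<partial>\<alpha>) \<le>
    (\<Sum>x\<in>B. \<bar>c x + ((\<Sum>i\<in>I. f i (x i)) + w x)\<bar>) * measure \<beta> (space \<beta>)"
proof -
  define g where "g = (\<lambda>x. c x + ((\<Sum>i\<in>I. f i (x i)) + w x))"
  have w: "w \<in> W" using fw by (simp add: dual_bound_def)
  have f: "f i \<in> borel_measurable (borel_of (X i))" if "i \<in> I" for i
    using fw that borel_measurable_integrable[of "\<mu> i" "f i"]
    by (simp add: dual_bound_def measurable_cong_sets[OF sets_marginal[OF that, symmetric] refl])
  have fT: "(\<lambda>x. f i (x i)) \<in> borel_measurable (borel_of T)" if "i \<in> I" for i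
    by (rule measurable_compose[OF measurable_coordinate[OF that] f[OF that]])
  note c' = continuous_map_borel_measurable[OF c]
  have gT: "g \<in> borel_measurable (borel_of T)"
    unfolding g_def by (intro borel_measurable_add borel_measurable_sum c' W_measurable w fT)
  have integrable: "integrable M u" if "sets M = sets (borel_of T)" "finite_measure M" "finite S"
    "AE x in M. x \<in> S" "u \<in> borel_measurable (borel_of T)" for M S and u :: "('i \<Rightarrow> 'a) \<Rightarrow> real"
    using finite_measure.integrable_AE_finite(1)[OF that(2,3,4), of u] that(5)
    by (simp add: measurable_cong_sets[OF that(1) refl])
  have eq: "(\<integral>x. g x \<partial>M) = (\<integral>x. c x \<partial>M) +
      ((\<Sum>i\<in>I. \<integral>y. f i y \<partial>distr M (borel_of (X i)) (\<lambda>x. x i)) + (\<integral>x. w x \<partial>M))"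
    if M: "sets M = sets (borel_of T)" "finite_measure M" "finite S" "AE x in M. x \<in> S" for M S
  proof -
    note int = integrable[OF M]
    have "(\<integral>y. f i y \<partial>distr M (borel_of (X i)) (\<lambda>x. x i)) = (\<integral>x. f i (x i) \<partial>M)" if "i \<in> I" for i
      using measurable_coordinate[OF that] f[OF that]
      by (intro integral_distr) (simp_all add: measurable_cong_sets[OF M(1) refl])
    then have "(\<Sum>i\<in>I. \<integral>y. f i y \<partial>distr M (borel_of (X i)) (\<lambda>x. x i)) = (\<Sum>i\<in>I. \<integral>x. f i (x i) \<partial>M)"
      by simp
    also have "\<dots> = (\<integral>x. (\<Sum>i\<in>I. f i (x i)) \<partial>M)"
      by (intro Bochner_Integration.integral_sum[symmetric] int fT)
    finally show ?thesis
      unfolding g_def using int[OF c'] int[OF W_measurable[OF w]]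
        Bochner_Integration.integrable_sum[of I M "\<lambda>i x. f i (x i)"] int[OF fT]
      by simp
  qed
  have "(\<Sum>i\<in>I. \<integral>y. f i y \<partial>distr \<alpha> (borel_of (X i)) (\<lambda>x. x i)) =
      (\<Sum>i\<in>I. \<integral>y. f i y \<partial>distr \<beta> (borel_of (X i)) (\<lambda>x. x i))"
    using marginal by simp
  moreover have "(\<integral>x. w x \<partial>\<alpha>) = (\<integral>x. w x \<partial>\<beta>)" using W w by blast
  ultimately have "(\<integral>x. c x \<partial>\<beta>) - (\<integral>x. c x \<partial>\<alpha>) = (\<integral>x. g x \<partial>\<beta>) - (\<integral>x. g x \<partial>\<alpha>)"
    using eq[OF \<alpha>] eq[OF \<beta>] by simp
  \<comment> \<open>Dropping this nonnegative term leaves an estimate in terms of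
    \<open>\<beta>\<close> alone.\<close>
  moreover have "0 \<le> (\<integral>x. g x \<partial>\<alpha>)"
  proof (rule Bochner_Integration.integral_nonneg)
    fix x assume "x \<in> space \<alpha>"
    then have "x \<in> topspace T" using sets_eq_imp_space_eq[OF \<alpha>(1)] by simp
    with fw have "- c x \<le> (\<Sum>i\<in>I. f i (x i)) + w x" by (simp add: dual_bound_def)
    then show "0 \<le> g x" unfolding g_def by linarith
  qed
  moreover have "\<bar>\<integral>x. g x \<partial>\<beta>\<bar> \<le> (\<Sum>x\<in>B. \<bar>g x\<bar>) * measure \<beta> (space \<beta>)"
    using gT by (intro finite_measure.integrable_AE_finite(2)[OF \<beta>(2,3,4)])
      (simp add: measurable_cong_sets[OF \<beta>(1) refl])
  ultimately show ?thesis unfolding g_def by linarith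
qed

text \<open>The finite projections of \<open>S\<close> carry the marginals of
  \<open>\<beta>\<close>, which are those of \<open>\<alpha>\<close>. Hence \<open>\<alpha>\<close>
  is carried by the product of these projections, a finite set that may be larger than
  \<open>S\<close>.\<close>

lemma AE_finite_of_marginals:
  assumes \<alpha>: "sets \<alpha> = sets (borel_of T)" and \<beta>: "sets \<beta> = sets (borel_of T)"
    and marginal: "\<forall>i\<in>I. distr \<alpha> (borel_of (X i)) (\<lambda>x. x i) = distr \<beta> (borel_of (X i)) (\<lambda>x. x i)"
    and S: "finite S" "S \<subseteq> topspace T" "AE x in \<beta>. x \<in> S"
  shows "\<exists>A. finite A \<and> (AE x in \<alpha>. x \<in> A)"
proof (intro exI conjI)
  define S' where "S' = (\<lambda>i. (\<lambda>x. x i) ` S)"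
  show "finite (Pi\<^sub>E I S')" using finite_index S(1) by (intro finite_PiE) (auto simp: S'_def)
  have m: "(\<lambda>x. x i) \<in> measurable M (borel_of (X i))" if "sets M = sets (borel_of T)" "i \<in> I" for M i
    using measurable_coordinate[OF that(2)] by (simp add: measurable_cong_sets[OF that(1) refl])
  have "AE x in \<alpha>. x i \<in> S' i" if i: "i \<in> I" for i
  proof -
    have sub: "S' i \<subseteq> topspace (X i)" using S(2) i coordinate_in_topspace by (auto simp: S'_def)
    have "closedin (X i) (S' i)"
      using sub S(1) polish_topology_facts(2)[OF polish[OF i]]
      by (intro closedin_Hausdorff_finite) (auto simp: S'_def)
    then have sets: "{y \<in> space (borel_of (X i)). y \<in> S' i} \<in> sets (borel_of (X i))"
      using closedin_borel_of sub by (simp add: Int_absorb1 Collect_conj_eq)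
    have "AE x in \<beta>. x i \<in> S' i"
      using S(3) by eventually_elim (simp add: S'_def)
    then have "AE y in distr \<beta> (borel_of (X i)) (\<lambda>x. x i). y \<in> S' i"
      by (simp add: AE_distr_iff[OF m[OF \<beta> i] sets])
    then have "AE y in distr \<alpha> (borel_of (X i)) (\<lambda>x. x i). y \<in> S' i"
      unfolding bspec[OF marginal i] .
    then show ?thesis by (simp add: AE_distr_iff[OF m[OF \<alpha> i] sets])
  qed
  then have "AE x in \<alpha>. \<forall>i\<in>I. x i \<in> S' i" using finite_index by (intro AE_finite_allI)
  moreover have "AE x in \<alpha>. x \<in> topspace T"
    using sets_eq_imp_space_eq[OF \<alpha>] by (intro AE_I2) simp
  ultimately show "AE x in \<alpha>. x \<in> Pi\<^sub>E I S'"
    by eventually_elim (simp add: PiE_iff topspace_product_topology)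
qed

section \<open>Monotonicity of the optimal plan\<close>

text \<open>Dual bounds within \<open>1 / (j + 1)\<close> of the plan's integral differ from the
  negative of \<open>c\<close> by nonnegative functions whose integrals tend to 0. Convergence in
  mean gives almost everywhere convergence of a subsequence.\<close>

lemma ex_vanishing_certificate:
  assumes c: "c \<in> dominated" "continuous_map T euclideanreal c"
    and gap: "dual (\<lambda>x. - c x) \<le> (\<integral>x. - c x \<partial>\<pi>0)"
  shows "\<exists>f w. (\<forall>j::nat. dual_bound (f j) (w j) (\<lambda>x. - c x)) \<and>
    (AE x in \<pi>0. (\<lambda>j. c x + ((\<Sum>i\<in>I. f j i (x i)) + w j x)) \<longlonglongrightarrow> 0)"
proof -
  have c': "(\<lambda>x. - c x) \<in> dominated" using scale_dominated[OF c(1), of "-1"] by simp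
  have int_c: "integrable \<pi>0 c"
    by (rule integrable_dominated[OF sets_plan marginal_plan c(1) continuous_map_borel_measurable[OF c(2)]])
  have *: "\<forall>j. \<exists>fw. dual_bound (fst fw) (snd fw) (\<lambda>x. - c x) \<and>
      (\<Sum>i\<in>I. \<integral>y. fst fw i y \<partial>\<mu> i) < (\<integral>x. - c x \<partial>\<pi>0) + 1 / real (Suc j)"
  proof (intro allI, rule ccontr)
    fix j
    assume n: "\<nexists>fw. dual_bound (fst fw) (snd fw) (\<lambda>x. - c x) \<and>
      (\<Sum>i\<in>I. \<integral>y. fst fw i y \<partial>\<mu> i) < (\<integral>x. - c x \<partial>\<pi>0) + 1 / real (Suc j)"
    \<comment> \<open>If no dual bound came this close, the infimum of the dual values would exceed
      the plan's integral by at least \<open>1 / (j + 1)\<close>, against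
      \<open>gap\<close>.\<close>
    have "(\<integral>x. - c x \<partial>\<pi>0) + 1 / real (Suc j) \<le> dual (\<lambda>x. - c x)"
    proof (rule le_dual[OF c'])
      fix f w assume "dual_bound f w (\<lambda>x. - c x)"
      moreover have "\<not> (dual_bound (fst (f, w)) (snd (f, w)) (\<lambda>x. - c x) \<and>
          (\<Sum>i\<in>I. \<integral>y. fst (f, w) i y \<partial>\<mu> i) < (\<integral>x. - c x \<partial>\<pi>0) + 1 / real (Suc j))"
        using n by (intro notI) (erule notE, rule exI)
      ultimately show "(\<integral>x. - c x \<partial>\<pi>0) + 1 / real (Suc j) \<le> (\<Sum>i\<in>I. \<integral>y. f i y \<partial>\<mu> i)"
        by (simp only: fst_conv snd_conv not_less simp_thms)
    qed
    with gap have "1 / real (Suc j) \<le> 0" by linarith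
    then show False by simp
  qed
  from choice[OF *] obtain fw where "\<forall>j. dual_bound (fst (fw j)) (snd (fw j)) (\<lambda>x. - c x) \<and>
      (\<Sum>i\<in>I. \<integral>y. fst (fw j) i y \<partial>\<mu> i) < (\<integral>x. - c x \<partial>\<pi>0) + 1 / real (Suc j)" ..
  then have fw: "dual_bound (fst (fw j)) (snd (fw j)) (\<lambda>x. - c x)"
    "(\<Sum>i\<in>I. \<integral>y. fst (fw j) i y \<partial>\<mu> i) < (\<integral>x. - c x \<partial>\<pi>0) + 1 / real (Suc j)" for j
    by blast+
  define g where "g = (\<lambda>j x. c x + ((\<Sum>i\<in>I. fst (fw j) i (x i)) + snd (fw j) x))"
  have int_g: "integrable \<pi>0 (g j)" for j
    unfolding g_def by (intro Bochner_Integration.integrable_add int_c plan_integral_dual_bound(1)[OF fw(1)])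
  have g_nonneg: "0 \<le> g j x" if "x \<in> topspace T" for j x
    using fw(1)[of j] that unfolding g_def dual_bound_def by force
  have "(\<integral>x. norm (g j x) \<partial>\<pi>0) \<le> 1 / real (Suc j)" for j
  proof -
    have "(\<integral>x. norm (g j x) \<partial>\<pi>0) = (\<integral>x. g j x \<partial>\<pi>0)"
      using g_nonneg by (intro Bochner_Integration.integral_cong refl) (simp add: space_plan)
    also have "\<dots> = (\<integral>x. c x \<partial>\<pi>0) + (\<Sum>i\<in>I. \<integral>y. fst (fw j) i y \<partial>\<mu> i)"
      unfolding g_def plan_integral_dual_bound(2)[OF fw(1), symmetric]
      by (intro Bochner_Integration.integral_add int_c plan_integral_dual_bound(1)[OF fw(1)])
    also have "\<dots> \<le> 1 / real (Suc j)" using fw(2)[of j] by simp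
    finally show ?thesis .
  qed
  then have "(\<lambda>j. \<integral>x. norm (g j x) \<partial>\<pi>0) \<longlonglongrightarrow> 0"
    by (intro tendsto_sandwich[OF _ _ tendsto_const LIMSEQ_inverse_real_of_nat])
       (auto simp: inverse_eq_divide intro!: always_eventually)
  \<comment> \<open>The certificate is reindexed along \<open>r\<close>; each of its members remains
    a dual bound.\<close>
  then obtain r where "AE x in \<pi>0. (\<lambda>j. g (r j) x) \<longlonglongrightarrow> 0"
    using tendsto_L1_AE_subseq[of \<pi>0 g] int_g by blast
  then show ?thesis
    using fw(1) unfolding g_def by (intro exI[of _ "\<lambda>j. fst (fw (r j))"] exI[of _ "\<lambda>j. snd (fw (r j))"]) simp
qed

text \<open>The estimate of \<open>integral_diff_le\<close> holds for every \<open>j\<close>. Since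
  \<open>S\<close> is finite, convergence at its points makes the right-hand side tend to 0.\<close>

lemma certificate_imp_le:
  assumes fw: "\<And>j::nat. dual_bound (f j) (w j) (\<lambda>x. - c x)" and c: "continuous_map T euclideanreal c"
    and lim: "\<And>x. x \<in> S \<Longrightarrow> (\<lambda>j. c x + ((\<Sum>i\<in>I. f j i (x i)) + w j x)) \<longlonglongrightarrow> 0"
    and \<alpha>: "sets \<alpha> = sets (borel_of T)" "finite_measure \<alpha>"
    and \<beta>: "sets \<beta> = sets (borel_of T)" "finite_measure \<beta>" "finite S" "supp T \<beta> = S"
    and marginal: "\<forall>i\<in>I. distr \<alpha> (borel_of (X i)) (\<lambda>x. x i) = distr \<beta> (borel_of (X i)) (\<lambda>x. x i)"
    and W: "\<forall>w\<in>W. (\<integral>x. w x \<partial>\<alpha>) = (\<integral>x. w x \<partial>\<beta>)"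
  shows "(\<integral>x. c x \<partial>\<beta>) \<le> (\<integral>x. c x \<partial>\<alpha>)"
proof -
  have AE_\<beta>: "AE x in \<beta>. x \<in> S"
    using AE_in_supp[OF second_countable_product \<beta>(1)] \<beta>(4) by simp
  have "S \<subseteq> topspace T" using \<beta>(4) by (auto simp: supp_def)
  then obtain A where A: "finite A" "AE x in \<alpha>. x \<in> A"
    using AE_finite_of_marginals[OF \<alpha>(1) \<beta>(1) marginal \<beta>(3) _ AE_\<beta>] by blast
  have "(\<lambda>j. (\<Sum>x\<in>S. \<bar>c x + ((\<Sum>i\<in>I. f j i (x i)) + w j x)\<bar>) * measure \<beta> (space \<beta>)) \<longlonglongrightarrow>
      (\<Sum>x\<in>S. \<bar>0\<bar>) * measure \<beta> (space \<beta>)"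
    by (intro tendsto_mult tendsto_const tendsto_sum tendsto_rabs lim)
  then have "(\<lambda>j. (\<Sum>x\<in>S. \<bar>c x + ((\<Sum>i\<in>I. f j i (x i)) + w j x)\<bar>) * measure \<beta> (space \<beta>)) \<longlonglongrightarrow> 0"
    by simp
  then have "(\<integral>x. c x \<partial>\<beta>) - (\<integral>x. c x \<partial>\<alpha>) \<le> 0"
    by (rule LIMSEQ_le_const)
       (use integral_diff_le[OF fw c \<alpha> A \<beta>(1,2,3) AE_\<beta> marginal W] in blast)
  then show ?thesis by simp
qed

end

theorem theorem3p6:
  fixes n :: nat
    and X :: "nat \<Rightarrow> 'a topology"
    and \<mu> :: "nat \<Rightarrow> 'a measure"
    and c :: "(nat \<Rightarrow> 'a) \<Rightarrow> real"
    and W :: "((nat \<Rightarrow> 'a) \<Rightarrow> real) set"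
    and \<pi>s :: "(nat \<Rightarrow> 'a) measure"
  assumes "n \<ge> 1"
    and "\<forall>k\<in>{1..n}. polish_topology (X k)"
    and "\<forall>k\<in>{1..n}. borel_prob (X k) (\<mu> k)"
    and "c \<in> C_L n X \<mu>"
    and "W \<subseteq> C_L n X \<mu>"
    and "function_subspace (topspace (prod_space n X)) W"
    and "\<forall>k\<in>{1..n}. \<forall>f\<in>C_L1 (X k) (\<mu> k).
           (\<lambda>x\<in>topspace (prod_space n X). f (x k)) \<in> W \<longrightarrow> (\<integral>y. f y \<partial>\<mu> k) = 0"
    and "is_arg_min (\<lambda>\<pi>. \<integral>x. c x \<partial>\<pi>) (\<lambda>\<pi>. \<pi> \<in> constrained_plans n X \<mu> W) \<pi>s"
  shows "\<exists>\<Gamma>. cW_monotone n X c W \<Gamma> \<and> \<Gamma> \<in> sets \<pi>s \<and> measure \<pi>s \<Gamma> = 1"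
proof -
  interpret polish_marginals "{1..n}" X \<mu>
    using assms(1-3) by unfold_locales auto
  note One_nat_def [simp del]
  have C_L: "h \<in> dominated" "continuous_map T euclideanreal h" if "h \<in> C_L n X \<mu>" for h
    using that unfolding C_L_def C_L1_def by (auto simp: dominated_def)
  have plans: "\<pi> \<in> constrained_plans n X \<mu> W \<longleftrightarrow> sets \<pi> = sets (borel_of T) \<and> prob_space \<pi> \<and>
      (\<forall>i\<in>{1..n}. distr \<pi> (borel_of (X i)) (\<lambda>x. x i) = \<mu> i) \<and> (\<forall>w\<in>W. (\<integral>x. w x \<partial>\<pi>) = 0)" for \<pi>
    by (simp add: constrained_plans_def transport_plans_def borel_prob_def marginal_def conj_assoc)
  have \<pi>s: "\<pi>s \<in> constrained_plans n X \<mu> W"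
    and optimal: "\<And>\<pi>. \<pi> \<in> constrained_plans n X \<mu> W \<Longrightarrow> (\<integral>x. c x \<partial>\<pi>s) \<le> (\<integral>x. c x \<partial>\<pi>)"
    using assms(8) by (auto simp: is_arg_min_def not_less)
  interpret constrained_plan "{1..n}" X \<mu> W \<pi>s
    using \<pi>s C_L assms(5,6) by unfold_locales (auto simp: plans)
  interpret prob_space \<pi>s using \<pi>s by (simp add: plans)
  note c = C_L[OF assms(4)]
  \<comment> \<open>Passing to the negative of \<open>c\<close> turns the minimality of
    \<open>\<pi>s\<close> into maximality, the form in which the dual problem was set up.\<close>
  have "dual (\<lambda>x. - c x) \<le> (\<integral>x. - c x \<partial>\<pi>s)"
  proof (rule dual_le_plan_integral)
    show "(\<lambda>x. - c x) \<in> dominated" using scale_dominated[OF c(1), of "-1"] by simp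
    show "continuous_map T euclideanreal (\<lambda>x. - c x)" using c(2) by (rule continuous_map_minus)
    fix \<pi> assume "sets \<pi> = sets (borel_of T)" "prob_space \<pi>"
      "\<forall>i\<in>{1..n}. distr \<pi> (borel_of (X i)) (\<lambda>x. x i) = \<mu> i" "\<forall>w\<in>W. (\<integral>x. w x \<partial>\<pi>) = 0"
    then have "\<pi> \<in> constrained_plans n X \<mu> W" by (simp add: plans)
    then show "(\<integral>x. - c x \<partial>\<pi>) \<le> (\<integral>x. - c x \<partial>\<pi>s)" using optimal by simp
  qed
  from ex_vanishing_certificate[OF c this] obtain f w
    where fw: "\<forall>j::nat. dual_bound (f j) (w j) (\<lambda>x. - c x)"
      and lim: "AE x in \<pi>s. (\<lambda>j. c x + ((\<Sum>i\<in>{1..n}. f j i (x i)) + w j x)) \<longlonglongrightarrow> 0"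
    by blast
  obtain N where N: "{x \<in> space \<pi>s. \<not> (\<lambda>j. c x + ((\<Sum>i\<in>{1..n}. f j i (x i)) + w j x)) \<longlonglongrightarrow> 0} \<subseteq> N"
    "emeasure \<pi>s N = 0" "N \<in> sets \<pi>s"
    using AE_E[OF lim] by blast
  \<comment> \<open>The certificate and the null set \<open>N\<close> are fixed before
    \<open>S\<close>, \<open>\<alpha>\<close> and \<open>\<beta>\<close>, so one set serves all of
    them.\<close>
  have "cW_monotone n X c W (space \<pi>s - N)"
    unfolding cW_monotone_def
  proof (intro conjI allI impI)
    show "space \<pi>s - N \<subseteq> topspace T" using space_plan by auto
    fix m S \<alpha> \<beta>
    assume S: "S \<subseteq> space \<pi>s - N \<and> finite S \<and> card S = m"
      and \<beta>: "finite_borel T \<beta> \<and> supp T \<beta> = S"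
      and \<alpha>: "finite_borel T \<alpha> \<and> W_equivalent n X W \<alpha> \<beta>"
    show "(\<integral>x. c x \<partial>\<beta>) \<le> (\<integral>x. c x \<partial>\<alpha>)"
    proof (rule certificate_imp_le[where S = S])
      show "dual_bound (f j) (w j) (\<lambda>x. - c x)" for j using fw by blast
      show "(\<lambda>j. c x + ((\<Sum>i\<in>{1..n}. f j i (x i)) + w j x)) \<longlonglongrightarrow> 0" if "x \<in> S" for x
        using that S N(1) by blast
    qed (use c S \<alpha> \<beta> in \<open>auto simp: finite_borel_def W_equivalent_def marginal_def\<close>)
  qed
  moreover have "space \<pi>s - N \<in> sets \<pi>s" using N(3) by blast
  moreover have "measure \<pi>s (space \<pi>s - N) = 1"
    using N(2) prob_compl[OF N(3)] by (simp add: measure_def)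
  ultimately show ?thesis by blast
qed

end
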